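(* Let $n,q,d,\Phi$ be positive integers with $1\le q\le n$, and let $\epsilon,\delta\in(0,1)$. For the all-cross-distances problem with these parameters there is a (randomized) sketch of size \[ O\left(\frac{n}{\epsilon^2}\left(\log n\cdot\log(1/\epsilon) + \log(d\Phi)\log\left(\frac{q}{\delta}\right)\right) + \mathrm{poly}(d,\log\Phi,\log(q/\delta),\log(1/\epsilon))\right) \] bits.
   Context: The problem is formalized in the one-way communication model with private randomness. Alice holds $n$ data points $X=\{x_1,\ldots,x_n\}\subset\{-\Phi,\ldots,\Phi\}^d$ (integer coordinates), and Bob holds $q$ query points $Y=\{y_1,\ldots,y_q\}\subset\{-\Phi,\ldots,\Phi\}^d$, where $1\le q\le n$. Distances are Euclidean. Alice, without knowing $Y$, computes a (possibly randomized) bit string called the sketch from $X$ and sends it to Bob, who must then produce the output from the sketch and $Y$. The size of the sketch is its length in bits. All-cross-distances problem: for every $i\in[n]$ and $j\in[q]$ Bob reports an estimate $E(i,j)$ such that $\Pr\left[\forall i\in[n],j\in[q],\ (1-\epsilon)\|x_i-y_j\|\le E(i,j)\le(1+\epsilon)\|x_i-y_j\|\right]\ge 1-\delta$.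
   Formalization: In the main term, log(1/ε) and log(q/δ) are read as max(1, log(1/ε)) and max(1, log(q/δ)); with the literal log(1/ε) the bound fails as ε tends to 1. The second guard matters only if q = 1 and δ > 1/2. *)

theory Defs
  imports "HOL-Probability.Probability"
begin

type_synonym point = "nat \<Rightarrow> int"

definition grid :: "nat \<Rightarrow> nat \<Rightarrow> point set" where
  "grid d \<Phi> = {1..d} \<rightarrow>\<^sub>E {- int \<Phi>..int \<Phi>}"

text \<open>Inputs are indexed families, since the estimates refer to the indices; repeated points
  are allowed.\<close>

definition inputs :: "nat \<Rightarrow> nat \<Rightarrow> nat \<Rightarrow> (nat \<Rightarrow> point) set" where
  "inputs m d \<Phi> = {1..m} \<rightarrow>\<^sub>E grid d \<Phi>"

definition edist :: "nat \<Rightarrow> point \<Rightarrow> point \<Rightarrow> real" where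
  "edist d x y = L2_set (\<lambda>k. real_of_int (x k - y k)) {1..d}"

text \<open>A one-way protocol with private randomness is a pair of probabilistic maps. Alice's map
  sees only her points, Bob's only the received bit string and his points. Binding the two
  distributions makes the random choices of the two parties independent given the sketch.\<close>

type_synonym alice = "(nat \<Rightarrow> point) \<Rightarrow> bool list pmf"
type_synonym bob = "bool list \<Rightarrow> (nat \<Rightarrow> point) \<Rightarrow> (nat \<Rightarrow> nat \<Rightarrow> real) pmf"

definition protocol_output ::
  "alice \<Rightarrow> bob \<Rightarrow> (nat \<Rightarrow> point) \<Rightarrow> (nat \<Rightarrow> point) \<Rightarrow> (nat \<Rightarrow> nat \<Rightarrow> real) pmf" where
  "protocol_output A B X Y = bind_pmf (A X) (\<lambda>s. B s Y)"

definition solves_all_cross_distances ::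
  "nat \<Rightarrow> nat \<Rightarrow> nat \<Rightarrow> nat \<Rightarrow> real \<Rightarrow> real \<Rightarrow> alice \<Rightarrow> bob \<Rightarrow> bool" where
  "solves_all_cross_distances n q d \<Phi> \<epsilon> \<delta> A B \<longleftrightarrow>
     (\<forall>X\<in>inputs n d \<Phi>. \<forall>Y\<in>inputs q d \<Phi>.
        measure_pmf.prob (protocol_output A B X Y)
          {E. \<forall>i\<in>{1..n}. \<forall>j\<in>{1..q}.
                (1 - \<epsilon>) * edist d (X i) (Y j) \<le> E i j \<and>
                E i j \<le> (1 + \<epsilon>) * edist d (X i) (Y j)}
        \<ge> 1 - \<delta>)"

text \<open>The size of a sketch is its length in the worst case over inputs and random choices.\<close>

definition sketch_size_at_most :: "nat \<Rightarrow> nat \<Rightarrow> nat \<Rightarrow> alice \<Rightarrow> real \<Rightarrow> bool" where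
  "sketch_size_at_most n d \<Phi> A b \<longleftrightarrow>
     (\<forall>X\<in>inputs n d \<Phi>. \<forall>s\<in>set_pmf (A X). real (length s) \<le> b)"

text \<open>The usual convention for logarithmic factors inside asymptotic bounds: a factor is never
  smaller than 1. The literal \<open>log (1/\<epsilon>)\<close> tends to 0 as \<open>\<epsilon>\<close> tends to 1, although
  the sketch must still separate zero from nonzero distances; \<open>log (q/\<delta>)\<close> tends to 0
  if \<open>q = 1\<close> and \<open>\<delta>\<close> tends to 1.
  The convention changes nothing if \<open>\<epsilon> \<le> 1/2\<close> and \<open>q/\<delta> \<ge> 2\<close>.\<close>

definition logf :: "real \<Rightarrow> real" where
  "logf x = max 1 (log 2 x)"

definition polynomial4 :: "(real \<Rightarrow> real \<Rightarrow> real \<Rightarrow> real \<Rightarrow> real) \<Rightarrow> bool" where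
  "polynomial4 p \<longleftrightarrow>
     (\<exists>(N::nat) (c :: nat \<Rightarrow> nat \<Rightarrow> nat \<Rightarrow> nat \<Rightarrow> real). \<forall>w x y z.
        p w x y z = (\<Sum>i\<le>N. \<Sum>j\<le>N. \<Sum>k\<le>N. \<Sum>l\<le>N. c i j k l * w ^ i * x ^ j * y ^ k * z ^ l))"

end

theory Submission
  imports Defs
begin

text \<open>Every point is projected by independent random sign vectors, arranged in blocks of
  \<open>O(1/\<epsilon>\<^sup>2)\<close>; the root mean square of a block is a \<open>(1 \<plusminus> O(\<epsilon>))\<close>-estimate of a norm with
  probability \<open>15/16\<close>, and a majority over \<open>\<kappa>\<close> blocks fails with probability \<open>2^-\<kappa>\<close>.

  The points carry a tree of nested nets with scales \<open>r s = 2^s r 0\<close>. A member \<open>u\<close> of the net of level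
  \<open>s\<close> stores its projections rounded to multiples of \<open>r s\<close>, encoded relative to its parent in the next
  net: a bounded number of bits per coordinate on average. The number of blocks stored there is
  \<open>O(log (m q / \<delta>))\<close>, where \<open>m\<close> is the number of points within distance \<open>O(r s / \<epsilon>)\<close> of \<open>u\<close>. That is
  enough for a union bound over all points, because a query at distance \<open>O(r s / \<epsilon>)\<close> from \<open>u\<close> gives
  \<open>u\<close> a rank of at most \<open>m\<close> in the order of distance to the query, and \<open>\<Sum>m. 1/m\<^sup>2\<close> converges.

  If \<open>u\<close> has no other net point within \<open>O(r s / \<epsilon>)\<close>, the \<open>m\<close> points are its descendants, so
  \<open>\<Sum>u. log m \<le> n\<close> on each of the \<open>O(log (d \<Phi>))\<close> levels. The other (crowded) nodes number
  \<open>O(n log (1/\<epsilon>))\<close> in total, and \<open>log m \<le> log n\<close> for them. If \<open>d \<le> 1/\<epsilon>\<^sup>2\<close> or \<open>n = 1\<close>, the points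
  are sent exactly; otherwise the sign vectors fit into the bound and are part of the sketch.\<close>

section \<open>Random signs\<close>

definition signs :: "'i set \<Rightarrow> ('i \<Rightarrow> real) set" where
  "signs I = (I \<rightarrow>\<^sub>E {-1, 1})"

lemma finite_signs [simp]: "finite I \<Longrightarrow> finite (signs I)"
  by (simp add: signs_def finite_PiE)

lemma card_signs: "finite I \<Longrightarrow> card (signs I) = 2 ^ card I"
  by (simp add: signs_def card_PiE numeral_2_eq_2)

lemma signs_square: "\<omega> \<in> signs I \<Longrightarrow> a \<in> I \<Longrightarrow> \<omega> a * \<omega> a = 1"
  by (auto simp: signs_def dest!: PiE_mem)

text \<open>The sum factors over the coordinates, and each coordinate in \<open>A\<close>
  contributes -1 + 1 = 0.\<close>

lemma sum_signs_monomial: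
  assumes "finite I" "A \<subseteq> I"
  shows "(\<Sum>\<omega>\<in>signs I. \<Prod>a\<in>A. \<omega> a) = (if A = {} then 2 ^ card I else 0)"
proof -
  have "(\<Sum>\<omega>\<in>signs I. \<Prod>a\<in>A. \<omega> a) = (\<Sum>\<omega>\<in>signs I. \<Prod>a\<in>I. if a \<in> A then \<omega> a else 1)"
    using assms by (intro sum.cong refl prod.mono_neutral_cong_left) auto
  also have "\<dots> = (\<Prod>a\<in>I. \<Sum>y\<in>{-1, 1::real}. if a \<in> A then y else 1)"
    unfolding signs_def by (rule prod_sum_PiE [symmetric]) (use assms in auto)
  also have "\<dots> = (\<Prod>a\<in>I. if a \<in> A then 0 else 2)"
    by (intro prod.cong) auto
  also have "\<dots> = (if A = {} then 2 ^ card I else 0)"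
    using assms by auto
  finally show ?thesis .
qed

lemma signs_monomial_mult:
  assumes "finite I" "A \<subseteq> I" "B \<subseteq> I" "\<omega> \<in> signs I"
  shows "(\<Prod>a\<in>A. \<omega> a) * (\<Prod>a\<in>B. \<omega> a) = (\<Prod>a\<in>(A - B) \<union> (B - A). \<omega> a)"
proof -
  have *: "(\<Prod>a\<in>C. \<omega> a) = (\<Prod>a\<in>I. if a \<in> C then \<omega> a else 1)" if "C \<subseteq> I" for C
    using assms(1) that by (intro prod.mono_neutral_cong_left) auto
  have sub: "(A - B) \<union> (B - A) \<subseteq> I"
    using assms by auto
  show ?thesis
    unfolding *[OF assms(2)] *[OF assms(3)] *[OF sub] prod.distrib [symmetric]
    using assms(4) by (intro prod.cong refl) (auto simp: signs_square)
qed

text \<open>Parseval's identity: the product of two monomials is the monomial of the symmetric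
  difference, which is empty only on the diagonal because \<open>A\<close> is injective.\<close>

lemma sum_signs_orthogonal:
  assumes "finite I" "finite T" "inj_on A T" "\<And>t. t \<in> T \<Longrightarrow> A t \<subseteq> I"
  shows "(\<Sum>\<omega>\<in>signs I. (\<Sum>t\<in>T. c t * (\<Prod>a\<in>A t. \<omega> a))\<^sup>2) = 2 ^ card I * (\<Sum>t\<in>T. (c t)\<^sup>2)"
proof -
  have "(\<Sum>\<omega>\<in>signs I. (\<Sum>t\<in>T. c t * (\<Prod>a\<in>A t. \<omega> a))\<^sup>2)
      = (\<Sum>\<omega>\<in>signs I. \<Sum>t\<in>T. \<Sum>t'\<in>T. c t * c t' * ((\<Prod>a\<in>A t. \<omega> a) * (\<Prod>a\<in>A t'. \<omega> a)))"
    by (simp add: power2_eq_square sum_product mult_ac)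
  also have "\<dots> = (\<Sum>\<omega>\<in>signs I. \<Sum>t\<in>T. \<Sum>t'\<in>T. c t * c t' * (\<Prod>a\<in>(A t - A t') \<union> (A t' - A t). \<omega> a))"
    using assms by (intro sum.cong refl) (simp add: signs_monomial_mult)
  also have "\<dots> = (\<Sum>t\<in>T. \<Sum>\<omega>\<in>signs I. \<Sum>t'\<in>T. c t * c t' * (\<Prod>a\<in>(A t - A t') \<union> (A t' - A t). \<omega> a))"
    by (rule sum.swap)
  also have "\<dots> = (\<Sum>t\<in>T. \<Sum>t'\<in>T. \<Sum>\<omega>\<in>signs I. c t * c t' * (\<Prod>a\<in>(A t - A t') \<union> (A t' - A t). \<omega> a))"
    by (intro sum.cong refl sum.swap)
  also have "\<dots> = (\<Sum>t\<in>T. \<Sum>t'\<in>T. if t' = t then c t * c t * 2 ^ card I else 0)"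
  proof (intro sum.cong refl)
    fix t t' assume t: "t \<in> T" "t' \<in> T"
    have "(\<Sum>\<omega>\<in>signs I. \<Prod>a\<in>(A t - A t') \<union> (A t' - A t). \<omega> a) =
        (if (A t - A t') \<union> (A t' - A t) = {} then 2 ^ card I else 0)"
      using assms(1) assms(4)[OF t(1)] assms(4)[OF t(2)] by (intro sum_signs_monomial) auto
    moreover have "(A t - A t') \<union> (A t' - A t) = {} \<longleftrightarrow> t' = t"
      using inj_onD[OF assms(3) _ t] by auto
    ultimately show "(\<Sum>\<omega>\<in>signs I. c t * c t' * (\<Prod>a\<in>(A t - A t') \<union> (A t' - A t). \<omega> a)) =
        (if t' = t then c t * c t * 2 ^ card I else 0)"
      by (simp flip: sum_distrib_left)
  qed
  also have "\<dots> = 2 ^ card I * (\<Sum>t\<in>T. (c t)\<^sup>2)"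
    using assms(2) by (simp add: sum_distrib_left power2_eq_square mult_ac)
  finally show ?thesis .
qed

text \<open>Each pair enters once, with \<open>k' < k\<close>, so that the mixed terms become
  distinct monomials in \<open>rms_row_variance\<close>.\<close>

lemma square_sum_pairs:
  fixes a :: "nat \<Rightarrow> real"
  shows "(\<Sum>k=1..d. a k)\<^sup>2 = (\<Sum>k=1..d. (a k)\<^sup>2) + (\<Sum>k=1..d. \<Sum>k'=1..<k. 2 * (a k * a k'))"
proof (induction d)
  case (Suc d)
  have "(\<Sum>k=1..Suc d. a k)\<^sup>2 = (\<Sum>k=1..d. a k)\<^sup>2 + (a (Suc d))\<^sup>2 + (\<Sum>k'=1..d. 2 * (a (Suc d) * a k'))"
    by (simp add: power2_sum sum_distrib_left mult_ac)
  then show ?case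
    using Suc by (simp add: atLeastLessThanSuc_atLeastAtMost)
qed simp

section \<open>Second moments of one block of projections\<close>

definition srow :: "nat \<Rightarrow> (nat \<times> nat \<Rightarrow> real) \<Rightarrow> nat \<Rightarrow> (nat \<Rightarrow> real) \<Rightarrow> real" where
  "srow d \<rho> l v = (\<Sum>k=1..d. \<rho> (l, k) * v k)"

definition rms :: "nat \<Rightarrow> (nat \<Rightarrow> real) \<Rightarrow> real" where
  "rms b h = L2_set h {..<b} / sqrt (real b)"

abbreviation sign_block :: "nat \<Rightarrow> nat \<Rightarrow> (nat \<times> nat \<Rightarrow> real) set" where
  "sign_block b d \<equiv> signs ({..<b} \<times> {1..d})"

lemma rms_power2: "(rms b h)\<^sup>2 = (\<Sum>l<b. (h l)\<^sup>2) / real b"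
  by (simp add: rms_def L2_set_def power_divide sum_nonneg)

lemma rms_nonneg: "rms b h \<ge> 0"
  by (simp add: rms_def)

lemma rms_row_second_moment:
  assumes "b > 0"
  shows "(\<Sum>\<rho>\<in>sign_block b d. (rms b (\<lambda>l. srow d \<rho> l v))\<^sup>2)
    = card (sign_block b d) * (L2_set v {1..d})\<^sup>2"
proof -
  let ?I = "{..<b} \<times> {1..d}"
  have row: "(\<Sum>\<rho>\<in>signs ?I. (srow d \<rho> l v)\<^sup>2) = 2 ^ card ?I * (\<Sum>k=1..d. (v k)\<^sup>2)" if "l < b" for l
  proof -
    have "(\<Sum>\<rho>\<in>signs ?I. (srow d \<rho> l v)\<^sup>2)
        = (\<Sum>\<rho>\<in>signs ?I. (\<Sum>k\<in>{1..d}. v k * (\<Prod>a\<in>{(l, k)}. \<rho> a))\<^sup>2)"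
      by (simp add: srow_def mult.commute)
    also have "\<dots> = 2 ^ card ?I * (\<Sum>k=1..d. (v k)\<^sup>2)"
      using that by (intro sum_signs_orthogonal) (auto simp: inj_on_def)
    finally show ?thesis .
  qed
  have "(\<Sum>\<rho>\<in>signs ?I. (rms b (\<lambda>l. srow d \<rho> l v))\<^sup>2) = (\<Sum>l<b. \<Sum>\<rho>\<in>signs ?I. (srow d \<rho> l v)\<^sup>2) / real b"
    by (subst sum.swap) (simp add: rms_power2 sum_divide_distrib)
  also have "\<dots> = 2 ^ card ?I * (\<Sum>k=1..d. (v k)\<^sup>2)"
    using assms by (simp add: row flip: One_nat_def)
  finally show ?thesis
    by (simp add: card_signs L2_set_def sum_nonneg)
qed

text \<open>Signs square to 1, so the diagonal terms give the squared norm exactly. The deviation is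
  a combination of monomials of degree two, to which \<open>sum_signs_orthogonal\<close>
  applies.\<close>

lemma rms_row_variance:
  assumes "b > 0"
  shows "(\<Sum>\<rho>\<in>sign_block b d. ((rms b (\<lambda>l. srow d \<rho> l v))\<^sup>2 - (L2_set v {1..d})\<^sup>2)\<^sup>2)
    \<le> card (sign_block b d) * (2 * (L2_set v {1..d}) ^ 4 / b)"
proof -
  let ?I = "{..<b} \<times> {1..d}"
  define D2 where "D2 = (\<Sum>k=1..d. (v k)\<^sup>2)"
  define T where "T = {..<b} \<times> (SIGMA k:{1..d}. {1..<k})"
  define A where "A = (\<lambda>(l::nat, k::nat, k'::nat). {(l, k), (l, k')})"
  define c where "c = (\<lambda>(l::nat, k, k'). 2 * (v k * v k'))"
  have finT: "finite T"
    by (simp add: T_def)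
  have sum_T: "(\<Sum>t\<in>T. F t) = (\<Sum>l<b. \<Sum>k=1..d. \<Sum>k'=1..<k. F (l, k, k'))" for F :: "_ \<Rightarrow> real"
    by (simp add: T_def sum.Sigma split_def)
  have inj: "inj_on A T"
    by (auto simp: inj_on_def A_def T_def doubleton_eq_iff)
  have expand: "(rms b (\<lambda>l. srow d \<rho> l v))\<^sup>2 - D2 = (\<Sum>t\<in>T. c t * (\<Prod>a\<in>A t. \<rho> a)) / b"
    if "\<rho> \<in> signs ?I" for \<rho>
  proof -
    have "(srow d \<rho> l v)\<^sup>2 = D2 + (\<Sum>k=1..d. \<Sum>k'=1..<k. c (l, k, k') * (\<Prod>a\<in>A (l, k, k'). \<rho> a))"
      if "l < b" for l
    proof -
      have "(\<rho> (l, k) * v k)\<^sup>2 = (v k)\<^sup>2" if "k \<in> {1..d}" for k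
        using signs_square[OF \<open>\<rho> \<in> signs ?I\<close>, of "(l, k)"] that \<open>l < b\<close>
        by (simp add: power_mult_distrib power2_eq_square)
      moreover have "(\<Sum>k=1..d. \<Sum>k'=1..<k. 2 * (\<rho> (l, k) * v k * (\<rho> (l, k') * v k')))
          = (\<Sum>k=1..d. \<Sum>k'=1..<k. c (l, k, k') * (\<Prod>a\<in>A (l, k, k'). \<rho> a))"
        by (intro sum.cong refl) (auto simp: c_def A_def)
      ultimately show ?thesis
        unfolding srow_def square_sum_pairs D2_def by simp
    qed
    then have "(\<Sum>l<b. (srow d \<rho> l v)\<^sup>2) = b * D2 + (\<Sum>t\<in>T. c t * (\<Prod>a\<in>A t. \<rho> a))"
      by (simp add: sum_T sum.distrib)
    then show ?thesis
      using assms by (simp add: rms_power2 field_simps)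
  qed
  \<comment> \<open>In each row the squared coefficients add up to twice the mixed terms in the
    square of the sum \<open>D2\<close>.\<close>
  have csum: "(\<Sum>t\<in>T. (c t)\<^sup>2) \<le> 2 * b * D2\<^sup>2"
  proof -
    have "(\<Sum>t\<in>T. (c t)\<^sup>2) = 2 * b * (\<Sum>k=1..d. \<Sum>k'=1..<k. 2 * ((v k)\<^sup>2 * (v k')\<^sup>2))"
      by (simp add: sum_T c_def power_mult_distrib sum_distrib_left mult_ac)
    also have "\<dots> \<le> 2 * b * D2\<^sup>2"
      unfolding D2_def square_sum_pairs by (intro mult_left_mono) (auto intro: sum_nonneg)
    finally show ?thesis .
  qed
  have D2: "(L2_set v {1..d})\<^sup>2 = D2"
    by (simp add: L2_set_def D2_def sum_nonneg)
  have "(\<Sum>\<rho>\<in>signs ?I. ((rms b (\<lambda>l. srow d \<rho> l v))\<^sup>2 - D2)\<^sup>2)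
      = (\<Sum>\<rho>\<in>signs ?I. (\<Sum>t\<in>T. c t * (\<Prod>a\<in>A t. \<rho> a))\<^sup>2) / b\<^sup>2"
    by (simp add: expand power_divide flip: sum_divide_distrib)
  also have "\<dots> = 2 ^ card ?I * (\<Sum>t\<in>T. (c t)\<^sup>2) / b\<^sup>2"
    using finT inj by (subst sum_signs_orthogonal) (auto simp: A_def T_def)
  also have "\<dots> \<le> 2 ^ card ?I * (2 * b * D2\<^sup>2) / b\<^sup>2"
    using csum by (intro divide_right_mono mult_left_mono) auto
  also have "\<dots> = 2 ^ card ?I * (2 * D2\<^sup>2 / b)"
    using assms by (simp add: power2_eq_square)
  also have "D2\<^sup>2 = (L2_set v {1..d}) ^ 4"
    by (simp flip: D2 power_mult)
  finally show ?thesis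
    unfolding D2 by (simp add: card_signs)
qed

text \<open>Chebyshev's inequality for the squared value: since \<open>W + D \<ge> D\<close>, a
  relative error above \<beta> in \<open>W\<close> forces an error of at least \<beta> times the
  squared norm in the square of \<open>W\<close>. The condition on \<open>b\<close> makes the
  failure probability 1/16.\<close>

lemma rms_row_chebyshev:
  assumes "b > 0" "\<beta> > 0" "32 / \<beta>\<^sup>2 \<le> b"
  shows "16 * card {\<rho> \<in> sign_block b d.
      \<not> \<bar>rms b (\<lambda>l. srow d \<rho> l v) - L2_set v {1..d}\<bar> \<le> \<beta> * L2_set v {1..d}} \<le> card (sign_block b d)"
proof -
  let ?G = "sign_block b d"
  define D where "D = L2_set v {1..d}"
  define W where "W = (\<lambda>\<rho>. rms b (\<lambda>l. srow d \<rho> l v))"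
  define B where "B = {\<rho> \<in> ?G. \<not> \<bar>W \<rho> - D\<bar> \<le> \<beta> * D}"
  have D0: "D \<ge> 0"
    by (simp add: D_def)
  have W0: "W \<rho> \<ge> 0" for \<rho>
    by (simp add: W_def rms_nonneg)
  have var: "(\<Sum>\<rho>\<in>?G. ((W \<rho>)\<^sup>2 - D\<^sup>2)\<^sup>2) \<le> card ?G * (2 * D ^ 4 / b)"
    unfolding D_def W_def by (rule rms_row_variance) (fact assms)
  have "16 * card B \<le> card ?G"
  proof (cases "D = 0")
    case True
    \<comment> \<open>For \<open>D = 0\<close> the variance bound itself vanishes, so every block
      estimates 0 exactly.\<close>
    then have "(\<Sum>\<rho>\<in>?G. ((W \<rho>)\<^sup>2 - D\<^sup>2)\<^sup>2) = 0"
      using var by (intro antisym sum_nonneg) auto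
    then have "\<forall>\<rho>\<in>?G. W \<rho> = 0"
      using True by (subst (asm) sum_nonneg_eq_0_iff) auto
    then have "B = {}"
      using True by (auto simp: B_def)
    then show ?thesis
      by simp
  next
    case False
    with D0 have D: "D > 0"
      by simp
    have "\<beta>\<^sup>2 * D ^ 4 \<le> ((W \<rho>)\<^sup>2 - D\<^sup>2)\<^sup>2" if "\<rho> \<in> B" for \<rho>
    proof -
      have "\<beta> * D * D \<le> \<bar>W \<rho> - D\<bar> * (W \<rho> + D)"
        using that D0 W0[of \<rho>] by (intro mult_mono) (auto simp: B_def)
      also have "\<dots> = \<bar>(W \<rho> - D) * (W \<rho> + D)\<bar>"
        using D0 W0[of \<rho>] by (simp add: abs_mult)
      also have "\<dots> = \<bar>(W \<rho>)\<^sup>2 - D\<^sup>2\<bar>"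
        by (simp add: power2_eq_square algebra_simps)
      finally have "(\<beta> * D * D)\<^sup>2 \<le> \<bar>(W \<rho>)\<^sup>2 - D\<^sup>2\<bar>\<^sup>2"
        using D0 assms by (intro power_mono) auto
      then show ?thesis
        by (simp add: power_mult_distrib power2_eq_square power4_eq_xxxx mult_ac)
    qed
    then have "(\<Sum>\<rho>\<in>B. \<beta>\<^sup>2 * D ^ 4) \<le> (\<Sum>\<rho>\<in>B. ((W \<rho>)\<^sup>2 - D\<^sup>2)\<^sup>2)"
      by (rule sum_mono)
    also have "\<dots> \<le> (\<Sum>\<rho>\<in>?G. ((W \<rho>)\<^sup>2 - D\<^sup>2)\<^sup>2)"
      by (intro sum_mono2) (auto simp: B_def)
    also have "\<dots> \<le> card ?G * (2 * D ^ 4 / b)"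
      by (fact var)
    finally have "card B * \<beta>\<^sup>2 * D ^ 4 \<le> card ?G * (2 / b) * D ^ 4"
      by (simp add: mult_ac)
    then have "card B * \<beta>\<^sup>2 \<le> card ?G * (2 / b)"
      by (rule mult_right_le_imp_le) (use D in simp)
    moreover have "2 / b \<le> \<beta>\<^sup>2 / 16"
      using assms by (simp add: field_simps)
    ultimately have "card B * \<beta>\<^sup>2 \<le> card ?G * (\<beta>\<^sup>2 / 16)"
      by (meson mult_left_mono of_nat_0_le_iff order_trans)
    then have "real (16 * card B) \<le> real (card ?G)"
      using assms by (simp add: field_simps)
    then show ?thesis
      by (rule of_nat_le_iff [THEN iffD1])
  qed
  then show ?thesis
    by (simp add: B_def W_def D_def)
qed

section \<open>Independent blocks, and counting by weights\<close>

lemma card_PiE_blocks: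
  assumes "Q \<subseteq> {..<S}" "finite G" "B \<subseteq> G"
  shows "card {\<sigma> \<in> {..<S} \<rightarrow>\<^sub>E G. \<forall>g\<in>Q. \<sigma> g \<in> B} = card B ^ card Q * card G ^ (S - card Q)"
proof -
  have "{\<sigma> \<in> {..<S} \<rightarrow>\<^sub>E G. \<forall>g\<in>Q. \<sigma> g \<in> B} = PiE {..<S} (\<lambda>g. if g \<in> Q then B else G)"
  proof (intro set_eqI iffI)
    fix \<sigma> assume \<sigma>: "\<sigma> \<in> PiE {..<S} (\<lambda>g. if g \<in> Q then B else G)"
    have "\<sigma> g \<in> B" if "g \<in> Q" for g
      using PiE_mem[OF \<sigma>, of g] that assms(1) by auto
    moreover have "\<sigma> \<in> {..<S} \<rightarrow>\<^sub>E G"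
      using subsetD[OF PiE_mono \<sigma>, of "\<lambda>_. G"] assms(3) by simp
    ultimately show "\<sigma> \<in> {\<sigma> \<in> {..<S} \<rightarrow>\<^sub>E G. \<forall>g\<in>Q. \<sigma> g \<in> B}"
      by simp
  qed (auto simp: PiE_iff)
  also have "card \<dots> = (\<Prod>g<S. if g \<in> Q then card B else card G)"
    by (subst card_PiE) (auto intro!: prod.cong)
  also have "\<dots> = (\<Prod>g\<in>Q. card B) * (\<Prod>g\<in>{..<S} - Q. card G)"
    using assms(1) by (subst prod.subset_diff[of Q]) (auto simp: mult.commute)
  also have "\<dots> = card B ^ card Q * card G ^ (S - card Q)"
    using assms(1) finite_subset[OF assms(1)] by (simp add: card_Diff_subset)
  finally show ?thesis .
qed

text \<open>A failing majority contains a set \<open>Q\<close> of at least \<kappa>/2 bad blocks. A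
  fixed such set is bad with probability at most 16^-|Q| \<le> 4^-\<kappa>, and there are at most
  2^\<kappa> sets.\<close>

lemma card_majority_fails:
  assumes "finite G" "B \<subseteq> G" "16 * card B \<le> card G" "\<kappa> \<le> S"
  shows "2 ^ \<kappa> * card {\<sigma> \<in> {..<S} \<rightarrow>\<^sub>E G. \<kappa> \<le> 2 * card {g. g < \<kappa> \<and> \<sigma> g \<in> B}} \<le> card ({..<S} \<rightarrow>\<^sub>E G)"
proof (cases "card G = 0")
  case True
  then have "\<kappa> = 0 \<or> {..<S} \<rightarrow>\<^sub>E G = {}"
    using assms by (cases "S = 0") (auto simp: PiE_eq_empty_iff)
  then show ?thesis
    using assms(1) by (auto intro!: card_mono finite_PiE)
next
  case False
  define \<Omega> where "\<Omega> = ({..<S} \<rightarrow>\<^sub>E G)"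
  define F where "F = (\<lambda>Q. {\<sigma> \<in> \<Omega>. \<forall>g\<in>Q. \<sigma> g \<in> B})"
  define \<Q> where "\<Q> = {Q. Q \<subseteq> {..<\<kappa>} \<and> \<kappa> \<le> 2 * card Q}"
  have fin: "finite \<Omega>"
    using assms(1) by (simp add: \<Omega>_def finite_PiE)
  have finQ: "finite \<Q>" and cardQ: "card \<Q> \<le> 2 ^ \<kappa>"
  proof -
    have "\<Q> \<subseteq> Pow {..<\<kappa>}"
      by (auto simp: \<Q>_def)
    then show "finite \<Q>" "card \<Q> \<le> 2 ^ \<kappa>"
      using card_mono[of "Pow {..<\<kappa>}" \<Q>] by (auto simp: card_Pow intro: finite_subset)
  qed
  have single: "4 ^ \<kappa> * card (F Q) \<le> card \<Omega>" if Q: "Q \<in> \<Q>" for Q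
  proof -
    have sub: "Q \<subseteq> {..<S}"
      using Q assms(4) by (auto simp: \<Q>_def)
    then have le: "card Q \<le> S"
      using card_mono[of "{..<S}" Q] by simp
    have "(4::nat) ^ \<kappa> \<le> 4 ^ (2 * card Q)"
      using Q by (intro power_increasing) (auto simp: \<Q>_def)
    then have "4 ^ \<kappa> * card (F Q) \<le> 16 ^ card Q * card (F Q)"
      by (intro mult_right_mono) (auto simp: power_mult)
    also have "\<dots> = (16 * card B) ^ card Q * card G ^ (S - card Q)"
      using card_PiE_blocks[OF sub assms(1,2)] by (simp add: F_def \<Omega>_def power_mult_distrib)
    also have "\<dots> \<le> card G ^ card Q * card G ^ (S - card Q)"
      by (intro mult_right_mono power_mono assms) auto
    also have "\<dots> = card \<Omega>"
      using le by (simp add: \<Omega>_def card_PiE flip: power_add)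
    finally show ?thesis .
  qed
  have "{\<sigma> \<in> \<Omega>. \<kappa> \<le> 2 * card {g. g < \<kappa> \<and> \<sigma> g \<in> B}} \<subseteq> (\<Union>Q\<in>\<Q>. F Q)"
  proof
    fix \<sigma> assume "\<sigma> \<in> {\<sigma> \<in> \<Omega>. \<kappa> \<le> 2 * card {g. g < \<kappa> \<and> \<sigma> g \<in> B}}"
    then show "\<sigma> \<in> (\<Union>Q\<in>\<Q>. F Q)"
      by (intro UN_I[of "{g. g < \<kappa> \<and> \<sigma> g \<in> B}"]) (auto simp: \<Q>_def F_def)
  qed
  then have "card {\<sigma> \<in> \<Omega>. \<kappa> \<le> 2 * card {g. g < \<kappa> \<and> \<sigma> g \<in> B}} \<le> card (\<Union>Q\<in>\<Q>. F Q)"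
    using fin finQ by (intro card_mono) (auto simp: F_def)
  also have "\<dots> \<le> (\<Sum>Q\<in>\<Q>. card (F Q))"
    by (rule card_UN_le) (fact finQ)
  finally have "4 ^ \<kappa> * card {\<sigma> \<in> \<Omega>. \<kappa> \<le> 2 * card {g. g < \<kappa> \<and> \<sigma> g \<in> B}} \<le> (\<Sum>Q\<in>\<Q>. 4 ^ \<kappa> * card (F Q))"
    by (simp flip: sum_distrib_left)
  also have "\<dots> \<le> (\<Sum>Q\<in>\<Q>. card \<Omega>)"
    by (rule sum_mono) (rule single)
  also have "\<dots> \<le> 2 ^ \<kappa> * card \<Omega>"
    using cardQ by simp
  finally have "4 ^ \<kappa> * card {\<sigma> \<in> \<Omega>. \<kappa> \<le> 2 * card {g. g < \<kappa> \<and> \<sigma> g \<in> B}} \<le> 2 ^ \<kappa> * card \<Omega>" .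
  moreover have "(4::nat) ^ \<kappa> = 2 ^ \<kappa> * 2 ^ \<kappa>"
    by (simp flip: power_mult_distrib)
  ultimately have "2 ^ \<kappa> * (2 ^ \<kappa> * card {\<sigma> \<in> \<Omega>. \<kappa> \<le> 2 * card {g. g < \<kappa> \<and> \<sigma> g \<in> B}}) \<le> 2 ^ \<kappa> * card \<Omega>"
    by (simp add: mult.assoc)
  then show ?thesis
    by (simp add: \<Omega>_def)
qed

text \<open>Markov's inequality for a product of independent factors, whose mean is at most c^S. The
  exponentially small failure probability later pays for a union bound over all points.\<close>

lemma card_block_product_exceeds:
  fixes F :: "'a \<Rightarrow> real" and c :: real
  assumes "finite G" "\<And>\<rho>. \<rho> \<in> G \<Longrightarrow> F \<rho> \<ge> 0" "(\<Sum>\<rho>\<in>G. F \<rho>) \<le> card G * c" "c > 0"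
  shows "2 ^ S * card {\<sigma> \<in> {..<S} \<rightarrow>\<^sub>E G. (2 * c) ^ S < (\<Prod>g<S. F (\<sigma> g))} \<le> card ({..<S} \<rightarrow>\<^sub>E G)"
proof -
  define \<Omega> where "\<Omega> = ({..<S} \<rightarrow>\<^sub>E G)"
  define B where "B = {\<sigma> \<in> \<Omega>. (2 * c) ^ S < (\<Prod>g<S. F (\<sigma> g))}"
  have fin: "finite \<Omega>"
    using assms(1) by (simp add: \<Omega>_def finite_PiE)
  have nonneg: "(\<Prod>g<S. F (\<sigma> g)) \<ge> 0" if "\<sigma> \<in> \<Omega>" for \<sigma>
    using that assms(2) by (intro prod_nonneg) (auto simp: \<Omega>_def)
  have "real (card B) * (2 * c) ^ S = (\<Sum>\<sigma>\<in>B. (2 * c) ^ S)"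
    by simp
  also have "\<dots> \<le> (\<Sum>\<sigma>\<in>B. \<Prod>g<S. F (\<sigma> g))"
    by (intro sum_mono) (auto simp: B_def)
  also have "\<dots> \<le> (\<Sum>\<sigma>\<in>\<Omega>. \<Prod>g<S. F (\<sigma> g))"
    using fin nonneg by (intro sum_mono2) (auto simp: B_def)
  also have "\<dots> = (\<Prod>g<S. \<Sum>\<rho>\<in>G. F \<rho>)"
    unfolding \<Omega>_def using assms(1) by (intro prod_sum_PiE [symmetric]) auto
  also have "\<dots> \<le> (\<Prod>g<S. card G * c)"
    using assms by (intro prod_mono) (auto intro: sum_nonneg)
  also have "\<dots> = card \<Omega> * c ^ S"
    by (simp add: \<Omega>_def card_PiE power_mult_distrib)
  finally have "(2 ^ S * card B) * c ^ S \<le> card \<Omega> * c ^ S"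
    by (simp add: power_mult_distrib mult_ac)
  then have "real (2 ^ S * card B) \<le> real (card \<Omega>)"
    by (subst (asm) mult_le_cancel_right) (use assms(4) in \<open>auto simp: not_less power_le_zero_eq\<close>)
  then show ?thesis
    unfolding of_nat_le_iff B_def \<Omega>_def .
qed

text \<open>A Kraft-type count: every member of \<open>Z\<close> has scaled weight at least 1, while
  the total weight of the full product space factors over the coordinates.\<close>

lemma card_PiE_le_weight:
  fixes w :: "'b \<Rightarrow> real" and c W :: real
  assumes "finite I" "finite M" "Z \<subseteq> I \<rightarrow>\<^sub>E M" "\<And>z. z \<in> M \<Longrightarrow> 0 \<le> w z" "(\<Sum>z\<in>M. w z) \<le> c" "W \<ge> 0"
    and "\<And>D. D \<in> Z \<Longrightarrow> 1 \<le> W * (\<Prod>i\<in>I. w (D i))"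
  shows "finite Z" "card Z \<le> W * c ^ card I"
proof -
  have fin: "finite (I \<rightarrow>\<^sub>E M)"
    using assms by (simp add: finite_PiE)
  then show "finite Z"
    using assms(3) by (rule rev_finite_subset)
  have "real (card Z) \<le> (\<Sum>D\<in>Z. W * (\<Prod>i\<in>I. w (D i)))"
    using sum_mono[of Z "\<lambda>_. 1", OF assms(7)] by simp
  also have "\<dots> \<le> (\<Sum>D\<in>I \<rightarrow>\<^sub>E M. W * (\<Prod>i\<in>I. w (D i)))"
    using fin assms by (intro sum_mono2) (auto intro!: mult_nonneg_nonneg prod_nonneg)
  also have "\<dots> = W * (\<Prod>i\<in>I. \<Sum>z\<in>M. w z)"
    using assms by (subst prod_sum_PiE) (auto simp: sum_distrib_left)
  also have "\<dots> \<le> W * (\<Prod>i\<in>I. c)"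
    using assms by (intro mult_left_mono prod_mono) (auto intro: sum_nonneg)
  finally show "card Z \<le> W * c ^ card I"
    by simp
qed

text \<open>The subtracted term makes the induction telescope.\<close>

lemma sum_inverse_square_int_le: "(\<Sum>z\<in>{- int m..int m}. 1 / (1 + \<bar>real_of_int z\<bar>)\<^sup>2) \<le> 4 - 2 / (1 + real m)"
proof (induction m)
  case (Suc m)
  have "{- int (Suc m)..int (Suc m)} = insert (- int (Suc m)) (insert (int (Suc m)) {- int m..int m})"
    by auto
  then have "(\<Sum>z\<in>{- int (Suc m)..int (Suc m)}. 1 / (1 + \<bar>real_of_int z\<bar>)\<^sup>2)
      = 2 / (2 + real m)\<^sup>2 + (\<Sum>z\<in>{- int m..int m}. 1 / (1 + \<bar>real_of_int z\<bar>)\<^sup>2)"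
    by simp
  also have "\<dots> \<le> 2 / (2 + real m)\<^sup>2 + (4 - 2 / (1 + real m))"
    using Suc by simp
  also have "2 / (2 + real m)\<^sup>2 \<le> 2 / (1 + real m) - 2 / (2 + real m)"
    by (simp add: divide_simps power2_eq_square)
  finally show ?case
    by simp
qed simp

text \<open>Weighting every \<open>D\<close> by \<open>W / (\<Prod>i\<in>I. (1 + \<bar>D i\<bar>)\<^sup>2)\<close> bounds the cardinality, since
  \<open>\<Sum>z. 1 / (1 + \<bar>z\<bar>)\<^sup>2 \<le> 4\<close>.\<close>

lemma card_bounded_products:
  fixes W :: real
  assumes "finite I" "W \<ge> 0"
  defines "Z \<equiv> {D \<in> I \<rightarrow>\<^sub>E (UNIV :: int set). (\<Prod>i\<in>I. (1 + \<bar>real_of_int (D i)\<bar>)\<^sup>2) \<le> W}"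
  shows "finite Z" "card Z \<le> W * 4 ^ card I"
proof -
  define w where "w = (\<lambda>z. (1 + \<bar>real_of_int z\<bar>)\<^sup>2)"
  have w1: "w z \<ge> 1" "w z \<ge> \<bar>real_of_int z\<bar>" for z
    by (auto simp: w_def power2_eq_square algebra_simps)
  define m where "m = nat \<lceil>W\<rceil>"
  \<comment> \<open>All factors are at least 1, so each one alone is at most \<open>W\<close>; this
    confines the entries to a finite range.\<close>
  have sub: "Z \<subseteq> (I \<rightarrow>\<^sub>E {- int m..int m})"
  proof
    fix D assume D: "D \<in> Z"
    have "D i \<in> {- int m..int m}" if "i \<in> I" for i
    proof -
      have "\<bar>real_of_int (D i)\<bar> \<le> (\<Prod>i\<in>{i}. w (D i))"
        using w1(2) by simp
      also have "\<dots> \<le> (\<Prod>i\<in>I. w (D i))"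
        using assms(1) that w1(1) by (intro prod_mono2) (auto intro: order_trans[OF _ w1(1)])
      also have "\<dots> \<le> W"
        using D by (simp add: Z_def w_def)
      finally show ?thesis
        by (simp add: m_def) linarith
    qed
    then show "D \<in> (I \<rightarrow>\<^sub>E {- int m..int m})"
      using D by (auto simp: Z_def PiE_iff)
  qed
  have "(\<Sum>z\<in>{- int m..int m}. 1 / w z) \<le> 4 - 2 / (1 + real m)"
    unfolding w_def by (rule sum_inverse_square_int_le)
  also have "\<dots> \<le> 4"
    by simp
  finally have total: "(\<Sum>z\<in>{- int m..int m}. 1 / w z) \<le> 4" .
  have weight: "1 \<le> W * (\<Prod>i\<in>I. 1 / w (D i))" if "D \<in> Z" for D
  proof -
    have "0 < (\<Prod>i\<in>I. w (D i))"
      by (intro prod_pos) (auto intro: less_le_trans[OF _ w1(1)])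
    then show ?thesis
      using that by (simp add: Z_def w_def prod_dividef)
  qed
  show "finite Z" "card Z \<le> W * 4 ^ card I"
    using card_PiE_le_weight[OF assms(1) _ sub _ total assms(2) weight] by (auto simp: w_def)
qed

section \<open>Hierarchical nets\<close>

text \<open>A greedy net: a further point joins exactly if no chosen point is within distance
  \<rho>.\<close>

lemma ex_separated_cover:
  fixes dst :: "'a \<Rightarrow> 'a \<Rightarrow> real"
  assumes "finite M" "\<And>u. dst u u = 0" "\<And>u v. dst u v = dst v u" "\<rho> \<ge> 0"
  shows "\<exists>N\<subseteq>M. (\<forall>u\<in>M. \<exists>v\<in>N. dst u v \<le> \<rho>) \<and> (\<forall>u\<in>N. \<forall>v\<in>N. u \<noteq> v \<longrightarrow> \<rho> < dst u v)"
  using assms(1)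
proof (induction M)
  case (insert x M)
  then obtain N where N: "N \<subseteq> M" "\<forall>u\<in>M. \<exists>v\<in>N. dst u v \<le> \<rho>"
    "\<forall>u\<in>N. \<forall>v\<in>N. u \<noteq> v \<longrightarrow> \<rho> < dst u v"
    by (elim exE conjE)
  show ?case
  proof (cases "\<exists>v\<in>N. dst x v \<le> \<rho>")
    case True
    have "N \<subseteq> insert x M"
      using N(1) by (rule subset_insertI2)
    moreover have "\<forall>u\<in>insert x M. \<exists>v\<in>N. dst u v \<le> \<rho>"
      using True N(2) by simp
    ultimately show ?thesis
      using N(3) by (intro exI[of _ N] conjI)
  next
    case False
    have "insert x N \<subseteq> insert x M"
      using N(1) by blast
    moreover have "\<forall>u\<in>insert x M. \<exists>v\<in>insert x N. dst u v \<le> \<rho>"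
      using N(2) assms(2)[of x] assms(4) by simp
    moreover have "\<forall>u\<in>insert x N. \<forall>v\<in>insert x N. u \<noteq> v \<longrightarrow> \<rho> < dst u v"
    proof -
      have "\<forall>v\<in>N. \<rho> < dst x v"
        using False by (simp add: not_le)
      moreover have "\<forall>v\<in>N. \<rho> < dst v x"
        using calculation unfolding assms(3)[of _ x] .
      ultimately show ?thesis
        using N(3) by simp
    qed
    ultimately show ?thesis
      by (intro exI[of _ "insert x N"] conjI)
  qed
next
  case empty
  show ?case
    by (intro exI[of _ "{}"]) simp
qed

text \<open>The parent of the node \<open>(u, s)\<close>. A point that survives to the next net is
  its own parent, so one level and one parent per point describe the whole tree.\<close>

definition nx :: "('a \<Rightarrow> nat) \<Rightarrow> ('a \<Rightarrow> 'a) \<Rightarrow> 'a \<Rightarrow> nat \<Rightarrow> 'a" where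
  "nx lev par u s = (if s < lev u then u else par u)"

primrec anc :: "('a \<Rightarrow> nat) \<Rightarrow> ('a \<Rightarrow> 'a) \<Rightarrow> nat \<Rightarrow> 'a \<Rightarrow> 'a" where
  "anc lev par 0 i = i"
| "anc lev par (Suc s) i = nx lev par (anc lev par s i) s"

text \<open>\<open>dst\<close> is a pseudometric, since different indices may carry equal points;
  therefore separation starts at level 1. The nets continue above \<open>H\<close> because the count
  of crowded points looks several levels up.\<close>

locale net_tree =
  fixes V :: "'a set" and dst :: "'a \<Rightarrow> 'a \<Rightarrow> real" and r :: "nat \<Rightarrow> real"
    and H :: nat and lev :: "'a \<Rightarrow> nat" and par :: "'a \<Rightarrow> 'a" and N :: "nat \<Rightarrow> 'a set"
  assumes finite_V: "finite V"
    and dst_refl: "dst u u = 0" and dst_sym: "dst u v = dst v u"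
    and dst_triangle: "dst u w \<le> dst u v + dst v w"
    and r0_pos: "r 0 > 0" and r_Suc: "r (Suc s) = 2 * r s"
    and N_0: "N 0 = V" and N_Suc: "N (Suc s) \<subseteq> N s"
    and N_separated: "u \<in> N (Suc s) \<Longrightarrow> v \<in> N (Suc s) \<Longrightarrow> u \<noteq> v \<Longrightarrow> r (Suc s) < dst u v"
    and mem_N_iff: "s \<le> H \<Longrightarrow> u \<in> N s \<longleftrightarrow> u \<in> V \<and> s \<le> lev u"
    and lev_PiE: "lev \<in> V \<rightarrow>\<^sub>E {..H}"
    and par_PiE: "par \<in> V \<rightarrow>\<^sub>E V"
    and par_N: "u \<in> V \<Longrightarrow> lev u < H \<Longrightarrow> par u \<in> N (Suc (lev u))"
    and dst_par: "u \<in> V \<Longrightarrow> lev u < H \<Longrightarrow> dst u (par u) \<le> r (Suc (lev u))"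

lemma ex_net_tree:
  fixes dst :: "'a \<Rightarrow> 'a \<Rightarrow> real" and r :: "nat \<Rightarrow> real"
  assumes "finite V" and dst: "\<And>u. dst u u = 0" "\<And>u v. dst u v = dst v u"
    "\<And>u v w. dst u w \<le> dst u v + dst v w" and r: "r 0 > 0" "\<And>s. r (Suc s) = 2 * r s"
  shows "\<exists>lev par N. net_tree V dst r H lev par N"
proof -
  have r_pos: "r s > 0" for s
    by (induction s) (use r in auto)
  have "\<exists>N. \<forall>s. (N s \<subseteq> V \<and> (s = 0 \<longrightarrow> N s = V)) \<and> (N (Suc s) \<subseteq> N s
      \<and> (\<forall>u\<in>N s. \<exists>v\<in>N (Suc s). dst u v \<le> r (Suc s))
      \<and> (\<forall>u\<in>N (Suc s). \<forall>v\<in>N (Suc s). u \<noteq> v \<longrightarrow> r (Suc s) < dst u v))"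
  proof (rule dependent_nat_choice)
    fix M and s :: nat assume M: "M \<subseteq> V \<and> (s = 0 \<longrightarrow> M = V)"
    then have "finite M"
      using assms(1) finite_subset by blast
    then have "\<exists>M'\<subseteq>M. (\<forall>u\<in>M. \<exists>v\<in>M'. dst u v \<le> r (Suc s)) \<and> (\<forall>u\<in>M'. \<forall>v\<in>M'. u \<noteq> v \<longrightarrow> r (Suc s) < dst u v)"
      by (rule ex_separated_cover) (rule dst(1), rule dst(2), rule less_imp_le, rule r_pos)
    then obtain M' where "M' \<subseteq> M \<and> (\<forall>u\<in>M. \<exists>v\<in>M'. dst u v \<le> r (Suc s))
      \<and> (\<forall>u\<in>M'. \<forall>v\<in>M'. u \<noteq> v \<longrightarrow> r (Suc s) < dst u v)"
      by (rule exE)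
    with M show "\<exists>M'. (M' \<subseteq> V \<and> (Suc s = 0 \<longrightarrow> M' = V)) \<and> (M' \<subseteq> M
      \<and> (\<forall>u\<in>M. \<exists>v\<in>M'. dst u v \<le> r (Suc s))
      \<and> (\<forall>u\<in>M'. \<forall>v\<in>M'. u \<noteq> v \<longrightarrow> r (Suc s) < dst u v))"
      by (intro exI[of _ M']) (simp add: subset_trans[of M' M V])
  qed simp
  then obtain N where *: "\<forall>s. (N s \<subseteq> V \<and> (s = 0 \<longrightarrow> N s = V)) \<and> (N (Suc s) \<subseteq> N s
      \<and> (\<forall>u\<in>N s. \<exists>v\<in>N (Suc s). dst u v \<le> r (Suc s))
      \<and> (\<forall>u\<in>N (Suc s). \<forall>v\<in>N (Suc s). u \<noteq> v \<longrightarrow> r (Suc s) < dst u v))"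
    by (rule exE)
  then have N: "\<And>s. N s \<subseteq> V" "N 0 = V" "\<And>s. N (Suc s) \<subseteq> N s"
    and cover: "\<And>s u. u \<in> N s \<Longrightarrow> \<exists>v\<in>N (Suc s). dst u v \<le> r (Suc s)"
    and sep: "\<And>s u v. u \<in> N (Suc s) \<Longrightarrow> v \<in> N (Suc s) \<Longrightarrow> u \<noteq> v \<Longrightarrow> r (Suc s) < dst u v"
    by simp_all
  have anti: "N t \<subseteq> N s" if "s \<le> t" for s t
    using N(3) that by (rule lift_Suc_antimono_le)
  \<comment> \<open>Inserting 0 keeps the set nonempty for every \<open>u\<close>, as
    \<open>Max\<close> requires.\<close>
  define lev where "lev = (\<lambda>u\<in>V. Max (insert 0 {s. s \<le> H \<and> u \<in> N s}))"
  \<comment> \<open>A point of the top level gets itself as a default parent, which keeps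
    \<open>par\<close> a map into \<open>V\<close>.\<close>
  define par where "par = (\<lambda>u\<in>V. if lev u < H then SOME v. v \<in> N (Suc (lev u)) \<and> dst u v \<le> r (Suc (lev u)) else u)"
  have fin: "finite (insert 0 {s. s \<le> H \<and> u \<in> N s})" for u
    by simp
  have lev_le: "lev u \<le> H" if "u \<in> V" for u
    using fin that by (auto simp: lev_def)
  have lev_N: "u \<in> N (lev u)" if "u \<in> V" for u
    using Max_in[OF fin, of u] that N(2) by (auto simp: lev_def)
  have mem: "u \<in> N s \<longleftrightarrow> u \<in> V \<and> s \<le> lev u" if "s \<le> H" for u s
    using that N(1)[of s] lev_N[of u] anti[of s "lev u"] Max_ge[OF fin, of s u] by (cases "u \<in> V") (auto simp: lev_def)
  have par: "par u \<in> N (Suc (lev u)) \<and> dst u (par u) \<le> r (Suc (lev u))" if "u \<in> V" "lev u < H" for u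
  proof -
    have "\<exists>v. v \<in> N (Suc (lev u)) \<and> dst u v \<le> r (Suc (lev u))"
      using cover[OF lev_N[OF that(1)]] by blast
    from someI_ex[OF this] show ?thesis
      using that by (simp add: par_def)
  qed
  have "net_tree V dst r H lev par N"
  proof
    have "par u \<in> V" if "u \<in> V" for u
      using par[OF that] N(1) that by (cases "lev u < H") (auto simp: par_def)
    then show "par \<in> V \<rightarrow>\<^sub>E V"
      by (rule PiE_I) (simp_all add: par_def)
    show "lev \<in> V \<rightarrow>\<^sub>E {..H}"
      using lev_le by (intro PiE_I) (simp_all add: lev_def)
  qed (use assms N(1-3) sep mem par in \<open>simp_all\<close>)
  then show ?thesis
    by blast
qed

context net_tree
begin

lemma r_pos: "r s > 0"
  by (induction s) (use r0_pos r_Suc in auto)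

lemma r_add: "r (s + c) = 2 ^ c * r s"
  by (induction c) (auto simp: r_Suc)

lemma N_antimono: "s \<le> t \<Longrightarrow> N t \<subseteq> N s"
  using N_Suc by (rule lift_Suc_antimono_le)

lemma N_subset_V: "N s \<subseteq> V"
  using N_antimono[of 0 s] N_0 by simp

lemma finite_N: "finite (N s)"
  using N_subset_V finite_V by (rule finite_subset)

lemma nx_mem:
  assumes "u \<in> N s" "s < H"
  shows "nx lev par u s \<in> N (Suc s)" "dst u (nx lev par u s) \<le> r (Suc s)"
proof -
  have u: "u \<in> V" "s \<le> lev u"
    using assms mem_N_iff[of s u] by simp_all
  show "nx lev par u s \<in> N (Suc s)" "dst u (nx lev par u s) \<le> r (Suc s)"
    using u assms mem_N_iff[of "Suc s" u] par_N[of u] dst_par[of u] r_pos[of "Suc s"]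
    by (cases "s = lev u"; auto simp: nx_def dst_refl)+
qed

text \<open>The climb costs \<open>r 1 + ... + r s\<close>, a geometric sum of at most twice its
  last term.\<close>

lemma anc_mem:
  assumes "i \<in> V" "s \<le> H"
  shows "anc lev par s i \<in> N s" "dst i (anc lev par s i) \<le> 2 * r s"
  using assms(2)
proof (induction s)
  case 0
  { case 1 then show ?case using assms N_0 by simp }
  { case 2 then show ?case using r_pos[of 0] by (simp add: dst_refl) }
next
  case (Suc s)
  { case 1 then show ?case using Suc nx_mem(1)[of _ s] by simp }
  { case 2
    then have "dst i (anc lev par (Suc s) i) \<le> dst i (anc lev par s i) + r (Suc s)"
      using dst_triangle[of i "anc lev par (Suc s) i" "anc lev par s i"] nx_mem(2)[OF Suc(1)] by simp
    also have "\<dots> \<le> 2 * r s + r (Suc s)"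
      using Suc 2 by simp
    finally show ?case
      by (simp add: r_Suc) }
qed

definition ball_size :: "real \<Rightarrow> 'a \<Rightarrow> nat \<Rightarrow> nat" where
  "ball_size A u s = card {i \<in> V. dst i u \<le> A * r s}"

text \<open>Doubling the radius absorbs the step to the parent. Consequently a parent stores at
  least as many blocks as its child.\<close>

lemma ball_size_mono:
  assumes "A \<ge> 2" "u \<in> N s" "s < H"
  shows "ball_size A u s \<le> ball_size A (nx lev par u s) (Suc s)"
  unfolding ball_size_def
proof (intro card_mono)
  have "dst i (nx lev par u s) \<le> A * r (Suc s)" if "dst i u \<le> A * r s" for i
  proof -
    have "dst i (nx lev par u s) \<le> A * r s + 2 * r s"
      using dst_triangle[of i "nx lev par u s" u] nx_mem(2)[OF assms(2,3)] that by (simp add: r_Suc)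
    also have "\<dots> \<le> A * r s + A * r s"
      using assms(1) r_pos[of s] by (intro add_left_mono mult_right_mono) auto
    finally show ?thesis
      by (simp add: r_Suc)
  qed
  then show "{i \<in> V. dst i u \<le> A * r s} \<subseteq> {i \<in> V. dst i (nx lev par u s) \<le> A * r (Suc s)}"
    by auto
qed (use finite_V in auto)

text \<open>The summand 2 accounts for the distance of a point to its ancestor: if \<open>u\<close>
  is not crowded, every point within \<open>A * r s\<close> of \<open>u\<close> has \<open>u\<close>
  as its ancestor at level \<open>s\<close>.\<close>

definition crowded :: "real \<Rightarrow> nat \<Rightarrow> 'a set" where
  "crowded A s = {u \<in> N s. \<exists>v\<in>N s. v \<noteq> u \<and> dst u v \<le> (A + 2) * r s}"

text \<open>Each crowded point surviving \<open>c\<close> levels up has a neighbour that does not survive, and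
  different survivors have different neighbours because the survivors are far apart.\<close>

lemma card_crowded:
  assumes "2 * (A + 2) \<le> 2 ^ c" "c > 0"
  shows "card (crowded A s) + 2 * card (N (s + c)) \<le> 2 * card (N s)"
proof -
  let ?far = "N (s + c)"
  have sub: "?far \<subseteq> N s"
    by (rule N_antimono) simp
  obtain c' where c': "s + c = Suc c'"
    using assms(2) by (metis Suc_pred add_gr_0)
  have sep: "u = v" if "u \<in> ?far" "v \<in> ?far" "dst u v \<le> r (s + c)" for u v
    using N_separated[of u c' v] that c' by force
  \<comment> \<open>Two survivors with a common neighbour would be closer than the separation
    \<open>c\<close> levels up.\<close>
  have close: "2 * ((A + 2) * r s) \<le> r (s + c)"
    using mult_right_mono[OF assms(1), of "r s"] r_pos[of s] by (simp add: r_add)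
  define f where "f = (\<lambda>u. SOME v. v \<in> N s \<and> v \<noteq> u \<and> dst u v \<le> (A + 2) * r s)"
  have f: "f u \<in> N s \<and> f u \<noteq> u \<and> dst u (f u) \<le> (A + 2) * r s" if "u \<in> crowded A s" for u
    unfolding f_def by (rule someI_ex) (use that in \<open>auto simp: crowded_def\<close>)
  have "inj_on f (crowded A s \<inter> ?far)"
  proof (rule inj_onI)
    fix u v assume uv: "u \<in> crowded A s \<inter> ?far" "v \<in> crowded A s \<inter> ?far" "f u = f v"
    then have "dst u v \<le> 2 * ((A + 2) * r s)"
      using dst_triangle[of u v "f u"] f[of u] f[of v] dst_sym[of v "f v"] by auto
    with close uv show "u = v"
      by (intro sep) auto
  qed
  moreover have "f ` (crowded A s \<inter> ?far) \<subseteq> N s - ?far"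
  proof
    fix v assume "v \<in> f ` (crowded A s \<inter> ?far)"
    then obtain u where u: "u \<in> crowded A s" "u \<in> ?far" "v = f u"
      by blast
    have "0 \<le> dst u (f u)"
      using dst_triangle[of u u "f u"] dst_sym[of u "f u"] dst_refl[of u] by simp
    then have "v \<notin> ?far"
      using sep[of u v] u f[OF u(1)] close by auto
    with u f[OF u(1)] show "v \<in> N s - ?far"
      by simp
  qed
  \<comment> \<open>Crowded survivors and crowded nonsurvivors each number at most
    \<open>card (N s - N (s + c))\<close>, whence the factor 2.\<close>
  ultimately have "card (crowded A s \<inter> ?far) \<le> card (N s - ?far)"
    using finite_N by (intro card_inj_on_le) auto
  moreover have "card (crowded A s - ?far) \<le> card (N s - ?far)"
    using finite_N by (intro card_mono) (auto simp: crowded_def)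
  moreover have "card (crowded A s) = card (crowded A s \<inter> ?far) + card (crowded A s - ?far)"
    using finite_N[of s] by (intro card_Int_Diff) (simp add: crowded_def)
  moreover have "card (N s) = card ?far + card (N s - ?far)"
    using sub finite_N by (metis card_Diff_subset card_mono le_add_diff_inverse)
  ultimately show ?thesis
    by linarith
qed

text \<open>The differences \<open>card (N s) - card (N (s + c))\<close> telescope, leaving at most
  \<open>c\<close> net sizes.\<close>

lemma sum_card_crowded:
  assumes "2 * (A + 2) \<le> 2 ^ c" "c > 0"
  shows "(\<Sum>s<M. card (crowded A s)) \<le> 2 * c * card V"
proof -
  have shift: "(\<Sum>s<M. card (N s)) \<le> k * card V + (\<Sum>s<M. card (N (s + k)))" for k
  proof (induction k)
    case (Suc k)
    have "(\<Sum>s<M. card (N (s + k))) \<le> (\<Sum>s<Suc M. card (N (s + k)))"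
      by simp
    also have "\<dots> = card (N k) + (\<Sum>s<M. card (N (s + Suc k)))"
      by (subst sum.lessThan_Suc_shift) simp
    also have "card (N k) \<le> card V"
      using N_subset_V finite_V by (intro card_mono)
    finally show ?case
      using Suc by simp
  qed simp
  have "(\<Sum>s<M. card (crowded A s)) + 2 * (\<Sum>s<M. card (N (s + c))) \<le> 2 * (\<Sum>s<M. card (N s))"
    unfolding sum_distrib_left sum.distrib [symmetric] by (intro sum_mono card_crowded assms)
  with shift[of c] show ?thesis
    by linarith
qed

text \<open>\<open>h\<close> stands for the number of blocks stored at a node. A node that is not
  crowded pays linearly for its descendants, which partition \<open>V\<close> on each level; a
  crowded node pays \<open>hmax\<close>.\<close>

lemma sum_ball_size:
  fixes h :: "nat \<Rightarrow> real" and a hmax :: real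
  assumes A: "2 * (A + 2) \<le> 2 ^ c" "c > 0" "A \<ge> 0"
    and h: "\<And>m. 1 \<le> m \<Longrightarrow> m \<le> card V \<Longrightarrow> 0 \<le> h m \<and> h m \<le> a * m \<and> h m \<le> hmax" and "a \<ge> 0" "hmax \<ge> 0"
  shows "(\<Sum>s\<le>H. \<Sum>u\<in>N s. h (ball_size A u s)) \<le> (H + 1) * (a * card V) + 2 * c * card V * hmax"
proof -
  have level: "(\<Sum>u\<in>N s. h (ball_size A u s)) \<le> a * card V + card (crowded A s) * hmax" if s: "s \<le> H" for s
  proof -
    define C where "C = (\<lambda>u. {i \<in> V. anc lev par s i = u})"
    have "h (ball_size A u s) \<le> a * card (C u) + (if u \<in> crowded A s then hmax else 0)" if u: "u \<in> N s" for u
    proof -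
      have "u \<in> {i \<in> V. dst i u \<le> A * r s}"
        using u N_subset_V A(3) r_pos[of s] by (auto simp: dst_refl)
      then have pos: "1 \<le> ball_size A u s"
        unfolding ball_size_def using finite_V by (simp add: Suc_le_eq card_gt_0_iff) blast
      have le: "ball_size A u s \<le> card V"
        unfolding ball_size_def using finite_V by (intro card_mono) auto
      note hb = h[OF pos le]
      show ?thesis
      proof (cases "u \<in> crowded A s")
        case True
        have "0 \<le> a * card (C u)"
          using \<open>a \<ge> 0\<close> by simp
        with hb True show ?thesis
          by auto
      next
        case False
        have "{i \<in> V. dst i u \<le> A * r s} \<subseteq> C u"
        proof
          fix i assume i: "i \<in> {i \<in> V. dst i u \<le> A * r s}"
          define v where "v = anc lev par s i"
          have v: "v \<in> N s" "dst i v \<le> 2 * r s"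
            using anc_mem[of i s] i s by (auto simp: v_def)
          have "dst u v \<le> (A + 2) * r s"
            using dst_triangle[of u v i] dst_sym[of u i] v(2) i by (simp add: algebra_simps)
          with False v(1) u have "v = u"
            by (auto simp: crowded_def)
          with i show "i \<in> C u"
            by (simp add: C_def v_def)
        qed
        then have "ball_size A u s \<le> card (C u)"
          unfolding ball_size_def using finite_V by (intro card_mono) (auto simp: C_def)
        then have "a * ball_size A u s \<le> a * card (C u)"
          using \<open>a \<ge> 0\<close> by (intro mult_left_mono) auto
        with hb False show ?thesis
          by auto
      qed
    qed
    then have "(\<Sum>u\<in>N s. h (ball_size A u s)) \<le> (\<Sum>u\<in>N s. a * card (C u) + (if u \<in> crowded A s then hmax else 0))"
      by (rule sum_mono)
    also have "\<dots> = a * real (\<Sum>u\<in>N s. card (C u)) + (\<Sum>u\<in>N s. if u \<in> crowded A s then hmax else 0)"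
      by (simp add: sum.distrib sum_distrib_left)
    also have "(\<Sum>u\<in>N s. card (C u)) = card V"
      using sum.group[of V "N s" "anc lev par s" "\<lambda>_. 1::nat"] finite_V finite_N anc_mem(1) s
      by (auto simp: C_def)
    also have "(\<Sum>u\<in>N s. if u \<in> crowded A s then hmax else 0) = card (crowded A s) * hmax"
      using finite_N[of s] by (simp add: crowded_def flip: sum.inter_filter)
    finally show ?thesis .
  qed
  have "(\<Sum>s\<le>H. \<Sum>u\<in>N s. h (ball_size A u s)) \<le> (\<Sum>s\<le>H. a * card V + card (crowded A s) * hmax)"
    by (intro sum_mono level) simp
  also have "\<dots> = (H + 1) * (a * card V) + real (\<Sum>s<Suc H. card (crowded A s)) * hmax"
    by (simp add: sum.distrib sum_distrib_left lessThan_Suc_atMost algebra_simps)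
  also have "real (\<Sum>s<Suc H. card (crowded A s)) \<le> real (2 * c * card V)"
    using sum_card_crowded[OF A(1,2)] by (intro of_nat_mono)
  finally show ?thesis
    using \<open>hmax \<ge> 0\<close> by (simp add: mult_right_mono)
qed

end

text \<open>The points are handled in order of decreasing value, since the one of largest value has
  the maximal rank.\<close>

lemma sum_rank_le:
  fixes val :: "'a \<Rightarrow> real" and f :: "nat \<Rightarrow> real"
  assumes "finite P" and f: "\<And>k m. 1 \<le> k \<Longrightarrow> k \<le> m \<Longrightarrow> f m \<le> f k"
  shows "(\<Sum>x\<in>P. f (card {z \<in> P. val z \<le> val x})) \<le> (\<Sum>m=1..card P. f m)"
  using assms(1)
proof (induction "card P" arbitrary: P)
  case (Suc k)
  then have "P \<noteq> {}"
    by auto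
  then have "Max (val ` P) \<in> val ` P"
    using Suc(3) by (intro Max_in) auto
  then obtain x where "x \<in> P" and Max: "Max (val ` P) = val x"
    by blast
  then have x: "x \<in> P" "\<And>z. z \<in> P \<Longrightarrow> val z \<le> val x"
    using Suc(3) by (auto simp flip: Max)
  let ?Q = "P - {x}"
  have Q: "finite ?Q" "k = card ?Q"
    using Suc x by auto
  have "f (card {z \<in> P. val z \<le> val y}) \<le> f (card {z \<in> ?Q. val z \<le> val y})" if "y \<in> ?Q" for y
  proof (rule f)
    have "y \<in> {z \<in> ?Q. val z \<le> val y}"
      using that by simp
    then show "1 \<le> card {z \<in> ?Q. val z \<le> val y}"
      using Q(1) by (simp add: Suc_le_eq card_gt_0_iff) blast
    show "card {z \<in> ?Q. val z \<le> val y} \<le> card {z \<in> P. val z \<le> val y}"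
      using Suc(3) by (intro card_mono) auto
  qed
  then have "(\<Sum>y\<in>?Q. f (card {z \<in> P. val z \<le> val y})) \<le> (\<Sum>y\<in>?Q. f (card {z \<in> ?Q. val z \<le> val y}))"
    by (rule sum_mono)
  also have "\<dots> \<le> (\<Sum>m=1..k. f m)"
    using Suc(1)[OF Q(2,1)] Q(2) by simp
  finally have "(\<Sum>y\<in>?Q. f (card {z \<in> P. val z \<le> val y})) \<le> (\<Sum>m=1..k. f m)" .
  moreover have "{z \<in> P. val z \<le> val x} = P"
    using x by auto
  ultimately show ?case
    using Suc(2,3) x(1) by (simp add: sum.remove[of P x] flip: Suc(2))
qed simp

lemma sum_inverse_squares_le: "(\<Sum>m=1..k. 1 / (real m)\<^sup>2) \<le> 2"
proof (cases "k = 0")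
  case False
  then have "k > 0"
    by simp
  \<comment> \<open>The stronger bound telescopes by 1/(k+1)^2 \<le> 1/k - 1/(k+1).\<close>
  then have "(\<Sum>m=1..k. 1 / (real m)\<^sup>2) \<le> 2 - 1 / real k"
  proof (induction k rule: nat_induct_non_zero)
    case (Suc k)
    have "1 / (real (Suc k))\<^sup>2 \<le> 1 / real k - 1 / real (Suc k)"
      using Suc(1) by (simp add: divide_simps power2_eq_square)
    then show ?case
      using Suc by simp
  qed simp
  also have "\<dots> \<le> 2"
    by simp
  finally show ?thesis .
qed simp

section \<open>Counting and protocols\<close>

text \<open>Each value z gets weight 2^-z; these weights sum to at most 2 per index, and the bound
  on the sum makes every product of weights at least 2^-m.\<close>

lemma card_bounded_sums:
  fixes m :: nat
  assumes "finite I"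
  defines "Z \<equiv> {\<kappa> \<in> I \<rightarrow>\<^sub>E (UNIV :: nat set). (\<Sum>i\<in>I. \<kappa> i) \<le> m}"
  shows "finite Z" "real (card Z) \<le> 2 ^ (m + card I)"
proof -
  have sub: "Z \<subseteq> I \<rightarrow>\<^sub>E {..<Suc m}"
  proof
    fix \<kappa> assume \<kappa>: "\<kappa> \<in> Z"
    have "\<kappa> i < Suc m" if "i \<in> I" for i
      using member_le_sum[OF that, of \<kappa>] assms(1) \<kappa> by (auto simp: Z_def)
    with \<kappa> show "\<kappa> \<in> I \<rightarrow>\<^sub>E {..<Suc m}"
      by (auto simp: Z_def PiE_iff)
  qed
  have geo: "(\<Sum>z<Suc m. (1 / 2 :: real) ^ z) \<le> 2"
    by (subst geometric_sum) auto
  have weight: "1 \<le> 2 ^ m * (\<Prod>i\<in>I. (1 / 2 :: real) ^ \<kappa> i)" if "\<kappa> \<in> Z" for \<kappa>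
  proof -
    have "(1 / 2 :: real) ^ m \<le> (1 / 2) ^ (\<Sum>i\<in>I. \<kappa> i)"
      using that by (intro power_decreasing) (auto simp: Z_def)
    then show ?thesis
      by (simp add: power_sum power_one_over field_simps)
  qed
  show "finite Z" "real (card Z) \<le> 2 ^ (m + card I)"
    using card_PiE_le_weight[OF assms(1) _ sub _ geo _ weight] by (auto simp: power_add)
qed

lemma card_Sigma_le:
  fixes c :: real
  assumes "finite A" "\<And>a. a \<in> A \<Longrightarrow> real (card (F a)) \<le> c"
  shows "real (card (Sigma A F)) \<le> card A * c"
proof (cases "\<forall>a\<in>A. finite (F a)")
  case True
  then have "real (card (Sigma A F)) = (\<Sum>a\<in>A. real (card (F a)))"
    using assms(1) by (simp add: card_SigmaI)
  also have "\<dots> \<le> (\<Sum>a\<in>A. c)"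
    by (intro sum_mono assms)
  finally show ?thesis
    by simp
next
  \<comment> \<open>An infinite fibre makes \<open>Sigma A F\<close> infinite, and its cardinality
    is then 0 by convention.\<close>
  case False
  then obtain a where a: "a \<in> A" "infinite (F a)"
    by blast
  have "Pair a ` F a \<subseteq> Sigma A F"
    using a by auto
  then have "infinite (Sigma A F)"
    using a(2) by (meson finite_imageD finite_subset inj_on_convol_ident inj_onI prod.inject)
  moreover have "0 \<le> c"
    using assms(2)[OF a(1)] by (simp add: order_trans[OF of_nat_0_le_iff])
  ultimately show ?thesis
    by simp
qed

text \<open>The inequality of arithmetic and geometric means, from 1 + x \<le> exp x: after division
  by the mean the exponents add up to 0.\<close>

lemma prod_le_mean_power:
  fixes a :: "'a \<Rightarrow> real"
  assumes "finite L" "\<And>l. l \<in> L \<Longrightarrow> a l > 0"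
  shows "(\<Prod>l\<in>L. a l) \<le> ((\<Sum>l\<in>L. a l) / card L) ^ card L"
proof (cases "L = {}")
  case False
  define m where "m = (\<Sum>l\<in>L. a l) / card L"
  have card: "card L > 0"
    using False assms(1) by (simp add: card_gt_0_iff)
  have total: "(\<Sum>l\<in>L. a l) > 0"
    using assms False by (intro sum_pos)
  then have m: "m > 0"
    using card by (simp add: m_def)
  have "(\<Prod>l\<in>L. a l / m) \<le> (\<Prod>l\<in>L. exp (a l / m - 1))"
    using assms(2) m exp_ge_add_one_self[of "a l / m - 1" for l]
    by (intro prod_mono) (force simp: less_imp_le intro!: divide_nonneg_pos)
  also have "\<dots> = exp ((\<Sum>l\<in>L. a l) / m - card L)"
    using assms(1) by (simp add: exp_sum [symmetric] sum_subtractf sum_divide_distrib)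
  also have "(\<Sum>l\<in>L. a l) / m = card L"
    using total card by (simp add: m_def)
  finally show ?thesis
    using m by (simp add: prod_dividef m_def [symmetric])
qed simp

lemma rms_triangle: "rms b (\<lambda>l. f l + g l) \<le> rms b f + rms b g"
  unfolding rms_def add_divide_distrib [symmetric]
  by (intro divide_right_mono L2_set_triangle_ineq) simp

lemma rms_minus_commute: "rms b (\<lambda>l. f l - g l) = rms b (\<lambda>l. g l - f l)"
  by (simp add: rms_def L2_set_def power2_commute)

lemma rms_bound:
  assumes "\<And>l. l < b \<Longrightarrow> \<bar>f l\<bar> \<le> \<rho>" "\<rho> \<ge> 0"
  shows "rms b f \<le> \<rho>"
proof -
  have "(rms b f)\<^sup>2 \<le> (\<Sum>l<b. \<rho>\<^sup>2) / b"
    unfolding rms_power2 using assms by (intro divide_right_mono sum_mono) (auto simp: abs_le_square_iff [symmetric])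
  also have "\<dots> \<le> \<rho>\<^sup>2"
    by simp
  finally show ?thesis
    using assms(2) by (rule power2_le_imp_le)
qed

lemma rms_perturb:
  assumes "\<And>l. l < b \<Longrightarrow> \<bar>f l - g l\<bar> \<le> \<rho>" "\<rho> \<ge> 0"
  shows "\<bar>rms b f - rms b g\<bar> \<le> \<rho>"
  using rms_triangle[of b g "\<lambda>l. f l - g l"] rms_triangle[of b f "\<lambda>l. g l - f l"]
    rms_bound[of b "\<lambda>l. f l - g l" \<rho>] rms_minus_commute[of b f g] assms
  by auto

lemma rms_scale: "rms b (\<lambda>l. f l / \<rho>) = rms b f / \<bar>\<rho>\<bar>"
  by (simp add: rms_def L2_set_def power_divide real_sqrt_divide flip: sum_divide_distrib)

text \<open>Alice draws \<omega> uniformly and sends a fixed-length code of her state; rounding the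
  length up costs the extra bit. Bob is deterministic. States outside \<open>Z\<close> count as
  failures.\<close>

lemma protocol_of_states:
  fixes S :: "'c \<Rightarrow> (nat \<Rightarrow> point) \<Rightarrow> 's" and dec :: "'s \<Rightarrow> (nat \<Rightarrow> point) \<Rightarrow> nat \<Rightarrow> nat \<Rightarrow> real"
    and \<epsilon> \<delta> B :: real
  assumes \<Omega>: "finite \<Omega>" "\<Omega> \<noteq> {}" and Z: "finite Z" "real (card Z) \<le> 2 powr B" "B \<ge> 0"
    and good: "\<And>X Y. X \<in> inputs n d \<Phi> \<Longrightarrow> Y \<in> inputs q d \<Phi> \<Longrightarrow>
      (1 - \<delta>) * card \<Omega> \<le> card {\<omega>\<in>\<Omega>. S \<omega> X \<in> Z \<and> (\<forall>i\<in>{1..n}. \<forall>j\<in>{1..q}.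
         (1 - \<epsilon>) * edist d (X i) (Y j) \<le> dec (S \<omega> X) Y i j \<and>
         dec (S \<omega> X) Y i j \<le> (1 + \<epsilon>) * edist d (X i) (Y j))}"
  shows "\<exists>A C. solves_all_cross_distances n q d \<Phi> \<epsilon> \<delta> A C \<and> sketch_size_at_most n d \<Phi> A (B + 1)"
proof -
  define L where "L = nat \<lceil>B\<rceil>"
  have "real (card Z) \<le> 2 powr real L"
    using Z by (auto simp: L_def intro!: order_trans[OF Z(2)] powr_mono)
  then have "real (card Z) \<le> real (2 ^ L)"
    by (simp add: powr_realpow)
  then have "card Z \<le> card {xs :: bool list. set xs \<subseteq> UNIV \<and> length xs = L}"
    unfolding of_nat_le_iff by (subst card_lists_length_eq) auto
  moreover have "finite {xs :: bool list. set xs \<subseteq> UNIV \<and> length xs = L}"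
    by (rule finite_lists_length_eq) simp
  ultimately have "\<exists>e. e ` Z \<subseteq> {xs :: bool list. set xs \<subseteq> UNIV \<and> length xs = L} \<and> inj_on e Z"
    by (intro card_le_inj Z(1))
  then obtain e :: "'s \<Rightarrow> bool list" where e: "e ` Z \<subseteq> {xs. set xs \<subseteq> UNIV \<and> length xs = L}" "inj_on e Z"
    by blast
  \<comment> \<open>The empty string stands for all states outside \<open>Z\<close>, so the length
    bound holds for every random choice.\<close>
  define A where "A = (\<lambda>X. map_pmf (\<lambda>\<omega>. if S \<omega> X \<in> Z then e (S \<omega> X) else []) (pmf_of_set \<Omega>))"
  define C where "C = (\<lambda>s Y. return_pmf (dec (inv_into Z e s) Y))"
  have "solves_all_cross_distances n q d \<Phi> \<epsilon> \<delta> A C"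
    unfolding solves_all_cross_distances_def
  proof (intro ballI)
    fix X Y assume XY: "X \<in> inputs n d \<Phi>" "Y \<in> inputs q d \<Phi>"
    define G where "G = {E. \<forall>i\<in>{1..n}. \<forall>j\<in>{1..q}.
                (1 - \<epsilon>) * edist d (X i) (Y j) \<le> E i j \<and> E i j \<le> (1 + \<epsilon>) * edist d (X i) (Y j)}"
    define out where "out = (\<lambda>\<omega>. dec (inv_into Z e (if S \<omega> X \<in> Z then e (S \<omega> X) else [])) Y)"
    have "protocol_output A C X Y = map_pmf out (pmf_of_set \<Omega>)"
      by (simp add: protocol_output_def A_def C_def out_def map_pmf_def bind_assoc_pmf bind_return_pmf)
    then have "measure_pmf.prob (protocol_output A C X Y) G = card (\<Omega> \<inter> out -` G) / card \<Omega>"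
      using \<Omega> by (simp add: measure_pmf_of_set)
    also have "\<dots> \<ge> card {\<omega>\<in>\<Omega>. S \<omega> X \<in> Z \<and> dec (S \<omega> X) Y \<in> G} / card \<Omega>"
      using \<Omega>(1) e(2) by (intro divide_right_mono of_nat_mono card_mono) (auto simp: out_def)
    moreover have "card {\<omega>\<in>\<Omega>. S \<omega> X \<in> Z \<and> dec (S \<omega> X) Y \<in> G} / card \<Omega> \<ge> 1 - \<delta>"
    proof -
      have pos: "0 < real (card \<Omega>)"
        using \<Omega> by (simp add: card_gt_0_iff)
      show ?thesis
        using good[OF XY] by (simp only: pos_le_divide_eq[OF pos] G_def mem_Collect_eq)
    qed
    ultimately show "1 - \<delta> \<le> measure_pmf.prob (protocol_output A C X Y) G"
      by linarith
  qed
  moreover have "sketch_size_at_most n d \<Phi> A (B + 1)"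
    unfolding sketch_size_at_most_def
  proof (intro ballI)
    fix X s assume "s \<in> set_pmf (A X)"
    then have "length s \<le> L"
      using e(1) by (auto simp: A_def split: if_splits)
    moreover have "real L \<le> B + 1"
      using Z(3) unfolding L_def by linarith
    ultimately show "real (length s) \<le> B + 1"
      by linarith
  qed
  ultimately show ?thesis
    by blast
qed

text \<open>The estimates are trustworthy from the top down to the first level at which they exceed the
  threshold; there the additive error of order \<open>r s\<close> is a relative error of order \<open>\<epsilon>\<close>.\<close>

lemma threshold_estimate:
  fixes es Ds r :: "nat \<Rightarrow> real" and \<epsilon> :: real
  assumes \<epsilon>: "0 < \<epsilon>" "\<epsilon> < 1" and \<theta>: "\<theta> = 40 / \<epsilon>" and r0: "r 0 = \<epsilon> / 80" and r_Suc: "\<And>s. r (Suc s) = 2 * r s"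
    and valid: "\<And>s. s \<le> H \<Longrightarrow> 2 * Ds s \<le> 8 * \<theta> * r s \<Longrightarrow> \<bar>es s - Ds s\<bar> \<le> \<epsilon> / 8 * (es s + Ds s) + 2 * r s \<and> 0 \<le> es s"
    and nonneg: "\<And>s. 0 \<le> Ds s" and near: "\<And>s. s \<le> H \<Longrightarrow> \<bar>Ds s - Ds 0\<bar> \<le> 2 * r s"
    and step: "\<And>s. s < H \<Longrightarrow> Ds s \<le> Ds (Suc s) + r (Suc s)"
    and valid_H: "2 * Ds H \<le> 8 * \<theta> * r H" and int: "Ds 0 < 1 \<Longrightarrow> Ds 0 = 0"
  defines "out \<equiv> if \<exists>s\<le>H. \<theta> * r s \<le> es s then es (Max {s. s \<le> H \<and> \<theta> * r s \<le> es s}) else 0"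
  shows "(1 - \<epsilon>) * Ds 0 \<le> out \<and> out \<le> (1 + \<epsilon>) * Ds 0"
proof -
  have r_pos: "r s > 0" for s
    by (induction s) (use r0 r_Suc \<epsilon> in auto)
  have \<theta>40: "\<theta> \<ge> 40"
    using \<epsilon> by (simp add: \<theta> field_simps)
  \<comment> \<open>With \<epsilon> < 1 the error bound reads (7/8) D \<le> (9/8) e + 2 r for the
    distance D and the estimate e.\<close>
  have small: "Ds s \<le> 9 / 7 * (\<theta> * r s) + 16 / 7 * r s" if "s \<le> H" "2 * Ds s \<le> 8 * \<theta> * r s" "es s < \<theta> * r s" for s
  proof -
    have "\<epsilon> / 8 * (es s + Ds s) \<le> 1 / 8 * (es s + Ds s)"
      using \<epsilon> valid[OF that(1,2)] nonneg[of s] by (intro mult_right_mono) auto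
    moreover have "Ds s - es s \<le> \<epsilon> / 8 * (es s + Ds s) + 2 * r s"
      using valid[OF that(1,2)] by (simp only: abs_le_iff minus_diff_eq)
    ultimately have "Ds s - es s \<le> 1 / 8 * (es s + Ds s) + 2 * r s"
      by linarith
    with that(3) show ?thesis
      by (simp add: field_simps)
  qed
  \<comment> \<open>If level s + 1 is reliable and its estimate is below the threshold, its distance
    is at most about (9/7) \<theta> times the scale. Halving the scale at most doubles this ratio up
    to lower-order terms, which stays below 4 \<theta> because \<theta> \<ge> 40.\<close>
  have descend: "2 * Ds s \<le> 8 * \<theta> * r s" if "s \<le> H" "\<And>t. s < t \<Longrightarrow> t \<le> H \<Longrightarrow> es t < \<theta> * r t" for s
    using that
  proof (induction rule: inc_induct)
    case base
    show ?case by (fact valid_H)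
  next
    case (step s)
    have IH: "2 * Ds (Suc s) \<le> 8 * \<theta> * r (Suc s)"
      using step by auto
    have "Ds (Suc s) \<le> 9 / 7 * (\<theta> * r (Suc s)) + 16 / 7 * r (Suc s)"
      using step IH by (intro small) auto
    moreover have "40 * r s \<le> \<theta> * r s"
      using \<theta>40 r_pos[of s] by (intro mult_right_mono) auto
    moreover have "\<theta> * r (Suc s) = 2 * (\<theta> * r s)" "8 * \<theta> * r s = 8 * (\<theta> * r s)"
      by (simp_all add: r_Suc)
    ultimately show ?case
      using assms(9)[OF step(2)] r_pos[of s] r_Suc[of s] by linarith
  qed
  show ?thesis
  proof (cases "\<exists>s\<le>H. \<theta> * r s \<le> es s")
    case True
    define s where "s = Max {s. s \<le> H \<and> \<theta> * r s \<le> es s}"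
    have "s \<in> {s. s \<le> H \<and> \<theta> * r s \<le> es s}"
      unfolding s_def using True by (intro Max_in) auto
    then have s: "s \<le> H" "\<theta> * r s \<le> es s"
      by auto
    have "es t < \<theta> * r t" if "s < t" "t \<le> H" for t
      using Max_ge[of "{s. s \<le> H \<and> \<theta> * r s \<le> es s}" t] that by (force simp flip: s_def)
    then have "2 * Ds s \<le> 8 * \<theta> * r s"
      by (intro descend s)
    note v = valid[OF s(1) this]
    define e D where "e = es s" and "D = Ds 0"
    have e0: "e \<ge> 0" and D0: "D \<ge> 0"
      using v nonneg[of 0] by (auto simp: e_def D_def)
    have "40 * r s \<le> \<epsilon> * e"
      using s(2) \<epsilon> by (simp add: \<theta> e_def field_simps)
    \<comment> \<open>Exceeding the threshold 40/\<epsilon> is what converts the additive error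
      \<open>r s\<close> into a relative one.\<close>
    moreover have "\<epsilon> / 8 * Ds s \<le> \<epsilon> / 8 * D + \<epsilon> / 4 * r s"
      using near[OF s(1)] mult_left_mono[of "Ds s" "D + 2 * r s" "\<epsilon> / 8"] \<epsilon> by (simp add: D_def algebra_simps)
    moreover have "\<epsilon> / 4 * r s \<le> 1 / 4 * r s"
      using \<epsilon> r_pos[of s] by (intro mult_right_mono) auto
    moreover have "\<bar>e - D\<bar> \<le> \<epsilon> / 8 * e + \<epsilon> / 8 * Ds s + 4 * r s"
      using v near[OF s(1)] unfolding e_def D_def distrib_left by linarith
    moreover have "0 \<le> \<epsilon> * e"
      using \<epsilon> e0 by simp
    ultimately have err: "\<bar>e - D\<bar> \<le> \<epsilon> / 4 * e + \<epsilon> / 8 * D"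
      by linarith
    have "(1 - \<epsilon>) * D * (1 + \<epsilon> / 4) \<le> e * (1 + \<epsilon> / 4)"
    proof -
      have "0 \<le> \<epsilon> * (\<epsilon> * D)" "0 \<le> \<epsilon> * D"
        using \<epsilon> D0 by auto
      moreover have "(1 - \<epsilon>) * D * (1 + \<epsilon> / 4) = D - 3 / 4 * (\<epsilon> * D) - 1 / 4 * (\<epsilon> * (\<epsilon> * D))"
        by (simp add: field_simps)
      moreover have "e * (1 + \<epsilon> / 4) = e + \<epsilon> / 4 * e"
        by (simp add: field_simps)
      ultimately show ?thesis
        using err by linarith
    qed
    then have 1: "(1 - \<epsilon>) * D \<le> e"
      using \<epsilon> by (subst (asm) mult_le_cancel_right) auto
    have "e * (1 - \<epsilon> / 4) \<le> (1 + \<epsilon>) * D * (1 - \<epsilon> / 4)"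
    proof -
      have "0 \<le> \<epsilon> * D"
        using \<epsilon> D0 by simp
      moreover from this have "\<epsilon> * (\<epsilon> * D) \<le> 1 * (\<epsilon> * D)"
        using \<epsilon> by (intro mult_right_mono) auto
      moreover have "(1 + \<epsilon>) * D * (1 - \<epsilon> / 4) = D + 3 / 4 * (\<epsilon> * D) - 1 / 4 * (\<epsilon> * (\<epsilon> * D))"
        by (simp add: field_simps)
      moreover have "e * (1 - \<epsilon> / 4) = e - \<epsilon> / 4 * e"
        by (simp add: field_simps)
      ultimately show ?thesis
        using err by linarith
    qed
    then have "e \<le> (1 + \<epsilon>) * D"
      using \<epsilon> by (subst (asm) mult_le_cancel_right) auto
    with 1 True show ?thesis
      by (simp add: out_def s_def e_def D_def)
  next
    case False
    then have below: "es t < \<theta> * r t" if "t \<le> H" for t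
      using that linorder_not_less by blast
    \<comment> \<open>No level passes the threshold. As \<open>\<theta> * r 0 = 1/2\<close>, the
      bound is 9/14 + \<epsilon>/35 < 1, and integrality leaves only distance 0.\<close>
    have "Ds 0 \<le> 9 / 7 * (\<theta> * r 0) + 16 / 7 * r 0"
      using below by (intro small descend) auto
    also have "\<dots> < 1"
      using \<epsilon> by (simp add: \<theta> r0)
    finally have "Ds 0 = 0"
      by (rule int)
    with False show ?thesis
      by (auto simp: out_def)
  qed
qed

section \<open>The sketch\<close>

abbreviation rv :: "point \<Rightarrow> nat \<Rightarrow> real" where
  "rv x \<equiv> \<lambda>k. real_of_int (x k)"

lemma edist_rv: "edist d x y = L2_set (\<lambda>k. rv x k - rv y k) {1..d}"
  by (simp add: edist_def)

lemma edist_refl [simp]: "edist d x x = 0"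
  by (simp add: edist_def L2_set_def)

lemma edist_nonneg: "0 \<le> edist d x y"
  by (simp add: edist_def)

lemma edist_commute: "edist d x y = edist d y x"
  by (simp add: edist_def L2_set_def power2_commute)

lemma edist_triangle: "edist d x z \<le> edist d x y + edist d y z"
  using L2_set_triangle_ineq[of "\<lambda>k. rv x k - rv y k" "\<lambda>k. rv y k - rv z k" "{1..d}"]
  by (simp add: edist_rv)

lemma edist_less_1:
  assumes "edist d x y < 1"
  shows "edist d x y = 0"
proof -
  have "x k = y k" if "k \<in> {1..d}" for k
  proof (rule ccontr)
    assume "x k \<noteq> y k"
    then have "1 \<le> \<bar>x k - y k\<bar>"
      by simp
    then have "1 \<le> \<bar>real_of_int (x k - y k)\<bar>"
      by linarith
    also have "\<dots> = L2_set (\<lambda>k. real_of_int (x k - y k)) {k}"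
      by (simp add: L2_set_def)
    also have "\<dots> \<le> edist d x y"
      unfolding edist_def L2_set_def using that by (intro real_sqrt_le_mono sum_mono2) auto
    finally show False
      using assms by simp
  qed
  then show ?thesis
    by (simp add: edist_def L2_set_def)
qed

lemma L2_set_grid_le:
  assumes "x \<in> grid d \<Phi>"
  shows "L2_set (rv x) {1..d} \<le> real d * real \<Phi>"
proof -
  have "\<bar>rv x k\<bar> \<le> real \<Phi>" if "k \<in> {1..d}" for k
    using PiE_mem[OF assms[unfolded grid_def] that] by (simp add: abs_le_iff)
  then have "(\<Sum>k=1..d. \<bar>rv x k\<bar>) \<le> (\<Sum>k=1..d. real \<Phi>)"
    by (rule sum_mono)
  then show ?thesis
    using L2_set_le_sum_abs[of "rv x" "{1..d}"] by simp
qed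

lemma edist_grid_le:
  assumes "x \<in> grid d \<Phi>" "y \<in> grid d \<Phi>"
  shows "edist d x y \<le> 2 * (real d * real \<Phi>)"
proof -
  have "edist d x y \<le> edist d x (\<lambda>_. 0) + edist d (\<lambda>_. 0) y"
    by (rule edist_triangle)
  then show ?thesis
    using L2_set_grid_le[OF assms(1)] L2_set_grid_le[OF assms(2)] edist_commute[of d "\<lambda>_. 0" y]
    by (simp add: edist_rv)
qed

lemma srow_diff: "srow d \<rho> l (\<lambda>k. x k - y k) = srow d \<rho> l x - srow d \<rho> l y"
  by (simp add: srow_def right_diff_distrib sum_subtractf)

text \<open>Node \<open>(u, s)\<close> is the point \<open>u\<close> as a member of the net of level \<open>s\<close>; it carries \<open>\<kappa> (u, s)\<close>
  blocks of \<open>b\<close> coordinates. Bob recovers the rounded coordinates of a node from those of its parent.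
  The first argument of \<open>dpos\<close> is the number of levels above.\<close>

definition idx :: "nat \<Rightarrow> nat \<Rightarrow> nat \<Rightarrow> (nat \<times> nat \<Rightarrow> nat) \<Rightarrow> ((nat \<times> nat) \<times> nat \<times> nat) set" where
  "idx n H b \<kappa> = (SIGMA us:{1..n} \<times> {..H}. {..<\<kappa> us} \<times> {..<b})"

primrec dpos :: "(nat \<Rightarrow> nat) \<Rightarrow> (nat \<Rightarrow> nat) \<Rightarrow> nat \<Rightarrow> ((nat \<times> nat) \<times> nat \<times> nat \<Rightarrow> int) \<Rightarrow>
    nat \<Rightarrow> nat \<Rightarrow> nat \<times> nat \<Rightarrow> int" where
  "dpos lev par H D 0 u j = D ((u, H), j)"
| "dpos lev par H D (Suc h) u j =
    D ((u, H - Suc h), j) + 2 * dpos lev par H D h (nx lev par u (H - Suc h)) j"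

text \<open>Bob does not know the distance itself, but any two values each close to more than half of the
  block estimates are close to each other.\<close>

definition majority_value :: "nat \<Rightarrow> (nat \<Rightarrow> real) \<Rightarrow> real \<Rightarrow> real \<Rightarrow> real" where
  "majority_value K e \<beta> \<rho> = (SOME v. 0 \<le> v \<and> K < 2 * card {g. g < K \<and> \<bar>e g - v\<bar> \<le> \<beta> * v + \<rho>})"

lemma majority_value_close:
  assumes "0 \<le> D" "K < 2 * card {g. g < K \<and> \<bar>e g - D\<bar> \<le> \<beta> * D + \<rho>}"
  shows "\<bar>majority_value K e \<beta> \<rho> - D\<bar> \<le> \<beta> * (majority_value K e \<beta> \<rho> + D) + 2 * \<rho>
    \<and> 0 \<le> majority_value K e \<beta> \<rho>"
proof -
  define v where "v = majority_value K e \<beta> \<rho>"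
  have v: "0 \<le> v \<and> K < 2 * card {g. g < K \<and> \<bar>e g - v\<bar> \<le> \<beta> * v + \<rho>}"
    \<comment> \<open>The true distance \<open>D\<close> witnesses that a value with the required
      majority exists.\<close>
    unfolding v_def majority_value_def by (rule someI[of _ D]) (use assms in blast)
  have "{g. g < K \<and> \<bar>e g - D\<bar> \<le> \<beta> * D + \<rho>} \<inter> {g. g < K \<and> \<bar>e g - v\<bar> \<le> \<beta> * v + \<rho>} \<noteq> {}"
  proof
    assume disj: "{g. g < K \<and> \<bar>e g - D\<bar> \<le> \<beta> * D + \<rho>} \<inter> {g. g < K \<and> \<bar>e g - v\<bar> \<le> \<beta> * v + \<rho>} = {}"
    have "card {g. g < K \<and> \<bar>e g - D\<bar> \<le> \<beta> * D + \<rho>} + card {g. g < K \<and> \<bar>e g - v\<bar> \<le> \<beta> * v + \<rho>}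
        = card ({g. g < K \<and> \<bar>e g - D\<bar> \<le> \<beta> * D + \<rho>} \<union> {g. g < K \<and> \<bar>e g - v\<bar> \<le> \<beta> * v + \<rho>})"
      using disj by (intro card_Un_disjoint [symmetric]) auto
    also have "\<dots> \<le> card {..<K}"
      by (intro card_mono) auto
    finally show False
      using v assms(2) by simp
  qed
  then obtain g where "\<bar>e g - D\<bar> \<le> \<beta> * D + \<rho>" "\<bar>e g - v\<bar> \<le> \<beta> * v + \<rho>"
    by blast
  then have "\<bar>v - D\<bar> \<le> \<beta> * (v + D) + 2 * \<rho>"
    unfolding distrib_left by linarith
  with v show ?thesis
    by (simp add: v_def)
qed

section \<open>Parameters and the set of states\<close>

locale sketch =
  fixes n q d \<Phi> :: nat and \<epsilon> \<delta> :: real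
  assumes q: "1 \<le> q" "q \<le> n" and d: "1 \<le> d" and \<Phi>: "1 \<le> \<Phi>"
    and \<epsilon>: "0 < \<epsilon>" "\<epsilon> < 1" and \<delta>: "0 < \<delta>" "\<delta> < 1"
begin

definition \<theta> :: real where "\<theta> = 40 / \<epsilon>"
definition r :: "nat \<Rightarrow> real" where "r s = \<epsilon> / 80 * 2 ^ s"
text \<open>Chosen so that \<open>d * \<Phi> \<le> r H\<close>: the top scale dominates the norm of
  every input point.\<close>

definition H :: nat where "H = nat \<lceil>log 2 (80 * (real d * real \<Phi>) / \<epsilon>)\<rceil>"
text \<open>This is 32/\<beta>^2 for \<beta> = \<epsilon>/8, as \<open>rms_row_chebyshev\<close>
  demands.\<close>

definition b :: nat where "b = nat \<lceil>2048 / \<epsilon>\<^sup>2\<rceil>"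
text \<open>Makes 2^-kap0 m at most \<delta>/(8 q m^2): a share for each rank m that is summable
  over the ranks and then over the queries.\<close>

definition kap0 :: "nat \<Rightarrow> nat" where "kap0 m = nat \<lceil>2 * log 2 m + log 2 (q / \<delta>)\<rceil> + 3"
definition S :: nat where "S = kap0 n"
text \<open>The argument of the logarithm is \<open>2 * (8 * \<theta> + 2)\<close>, the separation
  needed to count crowded nodes.\<close>

definition c :: nat where "c = nat \<lceil>log 2 (640 / \<epsilon> + 4)\<rceil>"
definition kap_total :: nat where
  "kap_total = nat \<lfloor>real (H + 1) * ((2 + 5 * logf (q / \<delta>)) * n) + 2 * real c * n * S\<rfloor>"

abbreviation block :: "(nat \<times> nat \<Rightarrow> real) set" where "block \<equiv> sign_block b d"

definition coins :: "(nat \<Rightarrow> nat \<times> nat \<Rightarrow> real) set" where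
  "coins = ({..<S} \<rightarrow>\<^sub>E block)"

text \<open>Every entry contributes a factor 4, and the at most \<open>b * S\<close> entries at the
  top occurrence of each point a further 180 on average.\<close>

definition max_weight :: real where
  "max_weight = 4 ^ (b * kap_total) * (180 ^ (b * S)) ^ n"

definition kappas :: "(nat \<times> nat \<Rightarrow> nat) set" where
  "kappas = {\<kappa> \<in> {1..n} \<times> {..H} \<rightarrow>\<^sub>E UNIV. (\<Sum>us\<in>{1..n} \<times> {..H}. \<kappa> us) \<le> kap_total}"

text \<open>Bounding the product limits the total number of bits while a single difference may be
  large.\<close>

definition diffs :: "(nat \<times> nat \<Rightarrow> nat) \<Rightarrow> ((nat \<times> nat) \<times> nat \<times> nat \<Rightarrow> int) set" where
  "diffs \<kappa> = {D \<in> idx n H b \<kappa> \<rightarrow>\<^sub>E UNIV. (\<Prod>i\<in>idx n H b \<kappa>. (1 + \<bar>real_of_int (D i)\<bar>)\<^sup>2) \<le> max_weight}"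

definition states where
  "states = coins \<times> ({1..n} \<rightarrow>\<^sub>E {..H}) \<times> ({1..n} \<rightarrow>\<^sub>E {1..n}) \<times> Sigma kappas diffs"

definition level_estimate where
  "level_estimate st y i s = (case st of (\<sigma>, lev, par, \<kappa>, D) \<Rightarrow>
     let u = anc lev par s i in
     majority_value (\<kappa> (u, s))
       (\<lambda>g. rms b (\<lambda>l. r s * dpos lev par H D (H - s) u (g, l) - srow d (\<sigma> g) l y)) (\<epsilon> / 8) (r s))"

definition decode where
  "decode st Y i j = (let es = level_estimate st (rv (Y j)) i in
     if \<exists>s\<le>H. \<theta> * r s \<le> es s then es (Max {s. s \<le> H \<and> \<theta> * r s \<le> es s}) else 0)"

lemma r_Suc: "r (Suc s) = 2 * r s" and r_pos: "0 < r s" and r_0: "r 0 = \<epsilon> / 80"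
  using \<epsilon> by (auto simp: r_def)

lemma b_pos: "0 < b" and b_ge: "2048 / \<epsilon>\<^sup>2 \<le> b"
  using \<epsilon> by (auto simp: b_def)

lemma n_pos: "1 \<le> n"
  using q by simp

lemma log_q_\<delta>: "0 < log 2 (q / \<delta>)"
  using q(1) \<delta> by (simp add: field_simps)

lemma kap0_power:
  assumes "1 \<le> m"
  shows "8 * q * (real m)\<^sup>2 / \<delta> \<le> 2 ^ kap0 m"
proof -
  have "8 * q * (real m)\<^sup>2 / \<delta> = 8 * 2 powr (2 * log 2 m + log 2 (q / \<delta>))"
  proof -
    have "2 powr (2 * log 2 m + log 2 (q / \<delta>)) = 2 powr log 2 m * 2 powr log 2 m * 2 powr log 2 (q / \<delta>)"
      by (simp flip: powr_add)
    also have "\<dots> = real m * real m * (q / \<delta>)"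
      using assms q \<delta> by simp
    finally show ?thesis
      by (simp add: power2_eq_square)
  qed
  also have "\<dots> \<le> 8 * 2 powr (real (nat \<lceil>2 * log 2 m + log 2 (q / \<delta>)\<rceil>))"
    by (intro mult_left_mono powr_mono) (auto simp: real_nat_ceiling_ge)
  also have "\<dots> = 2 ^ kap0 m"
    by (simp add: kap0_def powr_realpow power_add)
  finally show ?thesis .
qed

lemma kap0_mono: "1 \<le> k \<Longrightarrow> k \<le> m \<Longrightarrow> kap0 k \<le> kap0 m"
  unfolding kap0_def by (intro add_right_mono nat_mono ceiling_mono) simp

lemma kap0_le:
  assumes "1 \<le> m"
  shows "real (kap0 m) \<le> 2 * log 2 m + 5 * logf (q / \<delta>)"
proof -
  have "real (nat \<lceil>2 * log 2 m + log 2 (q / \<delta>)\<rceil>) \<le> 2 * log 2 m + log 2 (q / \<delta>) + 1"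
  proof -
    have "0 \<le> 2 * log 2 m + log 2 (q / \<delta>)"
      using log_q_\<delta> assms by (intro add_nonneg_nonneg) auto
    then show ?thesis
      by linarith
  qed
  then show ?thesis
    by (simp add: kap0_def logf_def)
qed

lemma d\<Phi>_le_r_H: "real d * real \<Phi> \<le> r H"
proof -
  define z where "z = 80 * (real d * real \<Phi>) / \<epsilon>"
  have "z > 0"
    using d \<Phi> \<epsilon> by (simp add: z_def)
  then have "z = 2 powr (log 2 z)"
    by simp
  also have "\<dots> \<le> 2 powr real H"
    unfolding H_def z_def by (intro powr_mono real_nat_ceiling_ge) simp
  finally show ?thesis
    using \<epsilon> by (simp add: z_def r_def powr_realpow field_simps)
qed

lemma c_power: "2 * (8 * \<theta> + 2) \<le> 2 ^ c" and c_pos: "0 < c"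
proof -
  define z where "z = 640 / \<epsilon> + 4"
  have z: "z > 1"
    using \<epsilon> by (simp add: z_def add_pos_pos)
  then show "0 < c"
    by (simp add: c_def flip: z_def)
  have "z = 2 powr (log 2 z)"
    using z by simp
  also have "\<dots> \<le> 2 powr real c"
    unfolding c_def z_def by (intro powr_mono real_nat_ceiling_ge) simp
  finally show "2 * (8 * \<theta> + 2) \<le> 2 ^ c"
    by (simp add: z_def \<theta>_def powr_realpow)
qed

lemma max_weight_nonneg: "0 \<le> max_weight"
  by (simp add: max_weight_def)

lemma finite_idx: "finite (idx n H b \<kappa>)"
  by (simp add: idx_def)

lemma card_idx: "card (idx n H b \<kappa>) = b * (\<Sum>us\<in>{1..n} \<times> {..H}. \<kappa> us)"
  by (simp add: idx_def card_SigmaI sum_distrib_left mult.commute)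

lemma finite_coins: "finite coins" and card_coins: "card coins = 2 ^ (S * (b * d))"
proof -
  show "finite coins"
    by (simp add: coins_def finite_PiE)
  show "card coins = 2 ^ (S * (b * d))"
    by (simp add: coins_def card_PiE card_signs power_mult mult.commute)
qed

lemma finite_states: "finite states"
  and card_states: "real (card states) \<le>
    2 ^ (S * (b * d)) * (H + 1) ^ n * n ^ n * 2 ^ (kap_total + n * (H + 1)) * (max_weight * 4 ^ (b * kap_total))"
proof -
  have kappas: "finite kappas" "real (card kappas) \<le> 2 ^ (kap_total + n * (H + 1))"
    using card_bounded_sums[of "{1..n} \<times> {..H}" kap_total] by (simp_all add: kappas_def)
  have fin: "finite (diffs \<kappa>)" for \<kappa>
    unfolding diffs_def using max_weight_nonneg by (intro card_bounded_products finite_idx)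
  have "real (card (diffs \<kappa>)) \<le> max_weight * 4 ^ (b * kap_total)" if "\<kappa> \<in> kappas" for \<kappa>
  proof -
    have "real (card (diffs \<kappa>)) \<le> max_weight * 4 ^ card (idx n H b \<kappa>)"
      unfolding diffs_def using max_weight_nonneg by (intro card_bounded_products finite_idx)
    also have "\<dots> \<le> max_weight * 4 ^ (b * kap_total)"
      using that max_weight_nonneg
      by (intro mult_left_mono power_increasing) (auto simp: card_idx kappas_def)
    finally show ?thesis .
  qed
  then have "real (card (Sigma kappas diffs)) \<le> card kappas * (max_weight * 4 ^ (b * kap_total))"
    by (intro card_Sigma_le kappas)
  also have "\<dots> \<le> 2 ^ (kap_total + n * (H + 1)) * (max_weight * 4 ^ (b * kap_total))"
    using max_weight_nonneg by (intro mult_right_mono kappas) auto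
  finally have Sigma: "real (card (Sigma kappas diffs)) \<le> \<dots>" .
  have "real (card states) = real (2 ^ (S * (b * d)) * (H + 1) ^ n * n ^ n) * real (card (Sigma kappas diffs))"
    by (simp add: states_def card_cartesian_product card_coins card_PiE)
  also have "\<dots> \<le> real (2 ^ (S * (b * d)) * (H + 1) ^ n * n ^ n) *
      (2 ^ (kap_total + n * (H + 1)) * (max_weight * 4 ^ (b * kap_total)))"
    by (intro mult_left_mono Sigma) auto
  finally show "real (card states) \<le>
    2 ^ (S * (b * d)) * (H + 1) ^ n * n ^ n * 2 ^ (kap_total + n * (H + 1)) * (max_weight * 4 ^ (b * kap_total))"
    by (simp add: mult.assoc)
  show "finite states"
    unfolding states_def using kappas(1) fin finite_coins
    by (intro finite_cartesian_product finite_SigmaI finite_PiE) auto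
qed

end

text \<open>The parent's grid is twice as coarse, so its rounded value enters doubled. The three
  parts serve the step to a different point, a point that stays in the next net (the difference is
  then 0 or 1), and the top level, which has no parent.\<close>

lemma floor_diff_bounds:
  fixes x y \<rho> :: real
  assumes "\<rho> > 0"
  shows "\<bar>real_of_int (\<lfloor>x / \<rho>\<rfloor> - 2 * \<lfloor>y / (2 * \<rho>)\<rfloor>)\<bar> \<le> \<bar>(x - y) / \<rho>\<bar> + 2"
    and "\<bar>\<lfloor>x / \<rho>\<rfloor> - 2 * \<lfloor>x / (2 * \<rho>)\<rfloor>\<bar> \<le> 1"
    and "\<bar>real_of_int \<lfloor>x / \<rho>\<rfloor>\<bar> \<le> \<bar>x / \<rho>\<bar> + 2"
proof -
  have "y / (2 * \<rho>) = (y / \<rho>) / 2" "x / (2 * \<rho>) = (x / \<rho>) / 2" "(x - y) / \<rho> = x / \<rho> - y / \<rho>"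
    using assms by (simp_all add: field_simps)
  then show "\<bar>real_of_int (\<lfloor>x / \<rho>\<rfloor> - 2 * \<lfloor>y / (2 * \<rho>)\<rfloor>)\<bar> \<le> \<bar>(x - y) / \<rho>\<bar> + 2"
    "\<bar>\<lfloor>x / \<rho>\<rfloor> - 2 * \<lfloor>x / (2 * \<rho>)\<rfloor>\<bar> \<le> 1" "\<bar>real_of_int \<lfloor>x / \<rho>\<rfloor>\<bar> \<le> \<bar>x / \<rho>\<bar> + 2"
    by linarith+
qed

section \<open>Alice's state for a fixed input\<close>

locale sketch_points = sketch +
  fixes X :: "nat \<Rightarrow> point" and lev par :: "nat \<Rightarrow> nat" and N :: "nat \<Rightarrow> nat set"
  assumes X: "X \<in> inputs n d \<Phi>"
    and tree: "net_tree {1..n} (\<lambda>u v. edist d (X u) (X v)) r H lev par N"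
begin

sublocale T: net_tree "{1..n}" "\<lambda>u v. edist d (X u) (X v)" r H lev par N
  by (rule tree)

text \<open>The constant for which \<open>threshold_estimate\<close> consults a level: the query is
  within half of \<open>A * r s\<close> of the net point, so all points closer to the query lie in
  the ball counted by \<open>ball_size\<close>.\<close>

definition A :: real where "A = 8 * \<theta>"

definition kap :: "nat \<times> nat \<Rightarrow> nat" where
  "kap = (\<lambda>(u, s)\<in>{1..n} \<times> {..H}. if u \<in> N s then kap0 (T.ball_size A u s) else 0)"

definition pos :: "(nat \<Rightarrow> nat \<times> nat \<Rightarrow> real) \<Rightarrow> nat \<Rightarrow> nat \<Rightarrow> nat \<times> nat \<Rightarrow> int" where
  "pos \<sigma> u s = (\<lambda>(g, l). \<lfloor>srow d (\<sigma> g) l (rv (X u)) / r s\<rfloor>)"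

definition diff :: "(nat \<Rightarrow> nat \<times> nat \<Rightarrow> real) \<Rightarrow> (nat \<times> nat) \<times> nat \<times> nat \<Rightarrow> int" where
  "diff \<sigma> = (\<lambda>((u, s), j)\<in>idx n H b kap.
     pos \<sigma> u s j - (if s = H then 0 else 2 * pos \<sigma> (nx lev par u s) (Suc s) j))"

definition state where
  "state \<sigma> = (\<sigma>, lev, par, kap, diff \<sigma>)"

lemma A_ge: "320 \<le> A"
  using \<epsilon> by (simp add: A_def \<theta>_def field_simps)

lemma X_grid: "u \<in> {1..n} \<Longrightarrow> X u \<in> grid d \<Phi>"
  using X by (auto simp: inputs_def)

lemma ball_size_bounds:
  assumes "u \<in> {1..n}"
  shows "1 \<le> T.ball_size A u s" "T.ball_size A u s \<le> n"
proof -
  have "card {u} \<le> T.ball_size A u s"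
    unfolding T.ball_size_def using assms A_ge r_pos[of s] by (intro card_mono) auto
  then show "1 \<le> T.ball_size A u s"
    by simp
  have "T.ball_size A u s \<le> card {1..n}"
    unfolding T.ball_size_def by (intro card_mono) auto
  then show "T.ball_size A u s \<le> n"
    by simp
qed

lemma kap_eq: "u \<in> N s \<Longrightarrow> s \<le> H \<Longrightarrow> kap (u, s) = kap0 (T.ball_size A u s)"
  using T.N_subset_V[of s] by (auto simp: kap_def)

lemma kap_pos_imp: "(u, s) \<in> {1..n} \<times> {..H} \<Longrightarrow> 0 < kap (u, s) \<Longrightarrow> u \<in> N s"
  by (auto simp: kap_def split: if_splits)

lemma kap_le_S: "(u, s) \<in> {1..n} \<times> {..H} \<Longrightarrow> kap (u, s) \<le> S"
  using kap0_mono ball_size_bounds[of u s] by (auto simp: kap_def S_def)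

text \<open>Every stored block of a node is also stored at its parent, so Bob has the reference
  value for the difference.\<close>

lemma kap_nx:
  assumes "u \<in> N s" "s < H"
  shows "kap (u, s) \<le> kap (nx lev par u s, Suc s)"
proof -
  have "u \<in> {1..n}"
    using assms T.N_subset_V by blast
  then show ?thesis
    using assms T.nx_mem(1)[OF assms] T.ball_size_mono[OF _ assms, of A] A_ge ball_size_bounds[of u s]
    by (simp add: kap_eq kap0_mono)
qed

text \<open>An instance of \<open>sum_ball_size\<close>: \<open>kap0\<close> grows at most linearly
  because log m \<le> m, and it never exceeds \<open>S\<close>.\<close>

lemma kap_in_kappas: "kap \<in> kappas"
proof -
  define \<mu> where "\<mu> = logf (q / \<delta>)"
  have \<mu>: "1 \<le> \<mu>"
    by (simp add: \<mu>_def logf_def)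
  have h: "0 \<le> real (kap0 m) \<and> real (kap0 m) \<le> (2 + 5 * \<mu>) * real m \<and> real (kap0 m) \<le> real S"
    if "1 \<le> m" "m \<le> card {1..n}" for m
  proof -
    have "log 2 (real m) \<le> real m"
      using log2_of_power_le[of m m] that(1) by (simp add: less_imp_le)
    moreover have "5 * \<mu> \<le> 5 * \<mu> * real m"
      using \<mu> that(1) by simp
    ultimately have "real (kap0 m) \<le> (2 + 5 * \<mu>) * real m"
      using kap0_le[OF that(1)] unfolding \<mu>_def [symmetric] distrib_right by linarith
    moreover have "kap0 m \<le> S"
      using kap0_mono[OF that(1)] that(2) by (simp add: S_def)
    ultimately show ?thesis
      by simp
  qed
  have "(\<Sum>us\<in>{1..n} \<times> {..H}. kap us) = (\<Sum>s\<le>H. \<Sum>u\<in>{1..n}. kap (u, s))"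
    by (simp add: sum.cartesian_product' sum.swap[of _ "{..H}"])
  also have "\<dots> = (\<Sum>s\<le>H. \<Sum>u\<in>N s. kap0 (T.ball_size A u s))"
  proof (rule sum.cong [OF refl])
    fix s assume "s \<in> {..H}"
    then show "(\<Sum>u\<in>{1..n}. kap (u, s)) = (\<Sum>u\<in>N s. kap0 (T.ball_size A u s))"
      using T.N_subset_V[of s] by (intro sum.mono_neutral_cong_right) (auto simp: kap_def)
  qed
  finally have "real (\<Sum>us\<in>{1..n} \<times> {..H}. kap us) = (\<Sum>s\<le>H. \<Sum>u\<in>N s. real (kap0 (T.ball_size A u s)))"
    by simp
  also have "\<dots> \<le> (H + 1) * ((2 + 5 * \<mu>) * card {1..n}) + 2 * c * card {1..n} * S"
    using T.sum_ball_size[of A c "\<lambda>m. real (kap0 m)" "2 + 5 * \<mu>" "real S"] c_power c_pos A_ge h \<mu>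
    by (simp add: A_def)
  finally have "(\<Sum>us\<in>{1..n} \<times> {..H}. kap us) \<le> kap_total"
    unfolding kap_total_def by (intro le_nat_floor) (simp add: \<mu>_def)
  then show ?thesis
    by (auto simp: kappas_def kap_def)
qed

lemma diff_eq: "((u, s), j) \<in> idx n H b kap \<Longrightarrow>
    diff \<sigma> ((u, s), j) = pos \<sigma> u s j - (if s = H then 0 else 2 * pos \<sigma> (nx lev par u s) (Suc s) j)"
  by (simp add: diff_def)

text \<open>Induction from the top level downwards; \<open>kap_nx\<close> keeps the block index
  valid at the parent.\<close>

lemma dpos_eq:
  assumes "h \<le> H" "u \<in> N (H - h)" "g < kap (u, H - h)" "l < b"
  shows "dpos lev par H (diff \<sigma>) h u (g, l) = pos \<sigma> u (H - h) (g, l)"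
  using assms
proof (induction h arbitrary: u)
  case 0
  then have "((u, H), (g, l)) \<in> idx n H b kap"
    using T.N_subset_V[of H] by (auto simp: idx_def)
  then show ?case
    by (simp add: diff_eq)
next
  case (Suc h)
  have lt: "H - Suc h < H" and eq: "Suc (H - Suc h) = H - h"
    using Suc.prems(1) by auto
  have "((u, H - Suc h), (g, l)) \<in> idx n H b kap"
    using Suc.prems T.N_subset_V[of "H - Suc h"] by (auto simp: idx_def)
  moreover have "dpos lev par H (diff \<sigma>) h (nx lev par u (H - Suc h)) (g, l) =
      pos \<sigma> (nx lev par u (H - Suc h)) (H - h) (g, l)"
    using Suc.prems T.nx_mem(1)[OF Suc.prems(2) lt] kap_nx[OF Suc.prems(2) lt] eq
    by (intro Suc.IH) auto
  ultimately show ?case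
    using lt eq by (simp add: diff_eq)
qed

text \<open>The displacement stored at the top occurrence of \<open>u\<close>.\<close>

definition jump :: "nat \<Rightarrow> nat \<Rightarrow> real" where
  "jump u = (if lev u < H then (\<lambda>k. rv (X u) k - rv (X (par u)) k) else rv (X u))"

definition jump_size :: "nat \<Rightarrow> (nat \<times> nat \<Rightarrow> real) \<Rightarrow> real" where
  "jump_size u \<rho> = 1 + (rms b (\<lambda>l. srow d \<rho> l (jump u) / r (lev u)))\<^sup>2"

text \<open>Each \<open>jump_size\<close> has mean at most 1 + 4 = 5, because a jump has length at
  most \<open>2 * r (lev u)\<close>; the base 10 is twice this mean.\<close>

definition small_jumps :: "(nat \<Rightarrow> nat \<times> nat \<Rightarrow> real) \<Rightarrow> bool" where
  "small_jumps \<sigma> \<longleftrightarrow> (\<forall>u\<in>{1..n}. (\<Prod>g<S. jump_size u (\<sigma> g)) \<le> 10 ^ S)"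

lemma lev_le: "u \<in> {1..n} \<Longrightarrow> lev u \<le> H"
  using T.lev_PiE by auto

lemma L2_set_jump:
  assumes u: "u \<in> {1..n}"
  shows "L2_set (jump u) {1..d} \<le> 2 * r (lev u)"
proof (cases "lev u < H")
  case True
  then show ?thesis
    using T.dst_par[OF u True] by (simp add: jump_def edist_rv r_Suc)
next
  case False
  then have "lev u = H"
    using lev_le[OF u] by simp
  then show ?thesis
    using L2_set_grid_le[OF X_grid[OF u]] d\<Phi>_le_r_H r_pos[of H] by (simp add: jump_def)
qed

lemma card_large_jump:
  assumes u: "u \<in> {1..n}"
  shows "2 ^ S * card {\<sigma> \<in> coins. 10 ^ S < (\<Prod>g<S. jump_size u (\<sigma> g))} \<le> card coins"
proof -
  define R where "R = r (lev u)"
  have R: "R > 0"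
    by (simp add: R_def r_pos)
  have "(\<Sum>\<rho>\<in>block. jump_size u \<rho>) = card block + (\<Sum>\<rho>\<in>block. (rms b (\<lambda>l. srow d \<rho> l (jump u)))\<^sup>2) / R\<^sup>2"
    by (simp add: jump_size_def rms_scale R_def sum.distrib power_divide flip: sum_divide_distrib)
  also have "\<dots> = card block * (1 + (L2_set (jump u) {1..d})\<^sup>2 / R\<^sup>2)"
    using b_pos by (simp add: rms_row_second_moment distrib_left flip: One_nat_def)
  also have "\<dots> \<le> card block * (5 :: real)"
  proof (intro mult_left_mono)
    have "(L2_set (jump u) {1..d})\<^sup>2 \<le> (2 * R)\<^sup>2"
      using L2_set_jump[OF u] by (intro power_mono) (auto simp: R_def)
    then show "1 + (L2_set (jump u) {1..d})\<^sup>2 / R\<^sup>2 \<le> 5"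
      using R by (simp add: field_simps power_mult_distrib)
  qed simp
  finally have "(\<Sum>\<rho>\<in>block. jump_size u \<rho>) \<le> card block * (5 :: real)" .
  from card_block_product_exceeds[OF _ _ this, of S] show ?thesis
    by (simp add: coins_def jump_size_def)
qed

text \<open>Only the top occurrence of \<open>u\<close> pays for a displacement. Below it
  \<open>u\<close> is its own parent and the difference has absolute value at most 1.\<close>

lemma diff_bound:
  assumes i: "((u, s), (g, l)) \<in> idx n H b kap"
  shows "(1 + \<bar>real_of_int (diff \<sigma> ((u, s), (g, l)))\<bar>)\<^sup>2
    \<le> 4 * (if s = lev u then 18 * (1 + (srow d (\<sigma> g) l (jump u) / r (lev u))\<^sup>2) else 1)"
proof -
  have us: "(u, s) \<in> {1..n} \<times> {..H}" "g < kap (u, s)"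
    using i by (auto simp: idx_def)
  then have "u \<in> N s"
    using kap_pos_imp[of u s] by simp
  then have s: "s \<le> lev u"
    using T.mem_N_iff[of s u] us by auto
  define D where "D = diff \<sigma> ((u, s), (g, l))"
  have D: "D = pos \<sigma> u s (g, l) - (if s = H then 0 else 2 * pos \<sigma> (nx lev par u s) (Suc s) (g, l))"
    using i by (simp add: D_def diff_eq)
  show ?thesis
  proof (cases "s = lev u")
    case True
    define t where "t = srow d (\<sigma> g) l (jump u) / r (lev u)"
    have "\<bar>real_of_int D\<bar> \<le> \<bar>t\<bar> + 2"
    proof (cases "s = H")
      case True
      with \<open>s = lev u\<close> show ?thesis
        using floor_diff_bounds(3)[OF r_pos[of s]] by (simp add: D pos_def t_def jump_def)
    next
      case False
      with \<open>s = lev u\<close> us(1) show ?thesis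
        using floor_diff_bounds(1)[OF r_pos[of s]]
        by (auto simp: D pos_def t_def jump_def nx_def r_Suc srow_diff)
    qed
    then have "(1 + \<bar>real_of_int D\<bar>)\<^sup>2 \<le> (3 + \<bar>t\<bar>)\<^sup>2"
      by (intro power_mono) auto
    also have "\<dots> \<le> 2 * (9 + t\<^sup>2)"
    proof -
      have "0 \<le> (3 - \<bar>t\<bar>)\<^sup>2"
        by simp
      then show ?thesis
        by (simp add: power2_sum power2_diff)
    qed
    also have "\<dots> \<le> 4 * (18 * (1 + t\<^sup>2))"
      by (simp add: power2_eq_square)
    finally show ?thesis
      using True by (simp add: D_def t_def)
  next
    case False
    with s have "s < lev u"
      by simp
    moreover have "lev u \<le> H"
      using lev_le us by simp
    ultimately have "\<bar>D\<bar> \<le> 1"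
      using floor_diff_bounds(2)[OF r_pos[of s]] by (simp add: D pos_def nx_def r_Suc)
    then have "1 + \<bar>real_of_int D\<bar> \<le> 2"
      by linarith
    then have "(1 + \<bar>real_of_int D\<bar>)\<^sup>2 \<le> 2\<^sup>2"
      by (intro power_mono) auto
    with False show ?thesis
      by (simp add: D_def)
  qed
qed

text \<open>Each point pays at one level only. Within a block, the inequality of means replaces the
  product over the rows by a power of the mean square, and \<open>small_jumps\<close> bounds the
  product over the blocks.\<close>

lemma diff_weight:
  assumes "small_jumps \<sigma>"
  shows "(\<Prod>i\<in>idx n H b kap. (1 + \<bar>real_of_int (diff \<sigma> i)\<bar>)\<^sup>2) \<le> max_weight"
proof -
  define f where "f = (\<lambda>u g l. 18 * (1 + (srow d (\<sigma> g) l (jump u) / r (lev u))\<^sup>2))"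
  have f1: "1 \<le> f u g l" for u g l
    by (simp add: f_def)
  define a where "a = (\<lambda>((u, s), (g, l)). if s = lev u then f u g l else 1)"
  have "(\<Prod>i\<in>idx n H b kap. (1 + \<bar>real_of_int (diff \<sigma> i)\<bar>)\<^sup>2) \<le> (\<Prod>i\<in>idx n H b kap. 4 * a i)"
  proof (intro prod_mono conjI)
    fix i assume i: "i \<in> idx n H b kap"
    obtain u s g l where "i = ((u, s), (g, l))"
      by (metis surj_pair)
    then show "(1 + \<bar>real_of_int (diff \<sigma> i)\<bar>)\<^sup>2 \<le> 4 * a i"
      using diff_bound[of u s g l \<sigma>] i by (simp only: a_def f_def prod.case)
  qed simp
  also have "\<dots> = 4 ^ card (idx n H b kap) * (\<Prod>i\<in>idx n H b kap. a i)"
    by (simp add: prod.distrib)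
  also have "\<dots> \<le> 4 ^ (b * kap_total) * (180 ^ (b * S)) ^ n"
  proof (intro mult_mono)
    show "(4::real) ^ card (idx n H b kap) \<le> 4 ^ (b * kap_total)"
      using kap_in_kappas by (intro power_increasing) (auto simp: card_idx kappas_def)
    have "(\<Prod>i\<in>idx n H b kap. a i) = (\<Prod>us\<in>{1..n} \<times> {..H}. \<Prod>j\<in>{..<kap us} \<times> {..<b}. a (us, j))"
      unfolding idx_def by (subst prod.Sigma) auto
    also have "\<dots> = (\<Prod>u\<in>{1..n}. \<Prod>s\<le>H. \<Prod>j\<in>{..<kap (u, s)} \<times> {..<b}. a ((u, s), j))"
      by (simp add: prod.cartesian_product')
    also have "\<dots> \<le> (\<Prod>u\<in>{1..n}. 180 ^ (b * S))"
    proof (intro prod_mono conjI)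
      fix u assume u: "u \<in> {1..n}"
      have "(\<Prod>s\<le>H. \<Prod>j\<in>{..<kap (u, s)} \<times> {..<b}. a ((u, s), j))
          = (\<Prod>s\<le>H. if s = lev u then \<Prod>j\<in>{..<kap (u, s)} \<times> {..<b}. a ((u, s), j) else 1)"
        by (intro prod.cong refl) (auto simp: a_def intro!: prod.neutral)
      also have "\<dots> = (\<Prod>(g, l)\<in>{..<kap (u, lev u)} \<times> {..<b}. f u g l)"
        using lev_le[OF u] by (simp add: prod.delta a_def split_def)
      also have "\<dots> = (\<Prod>g<kap (u, lev u). \<Prod>l<b. f u g l)"
        by (simp add: prod.cartesian_product)
      \<comment> \<open>All factors are at least 1, so the product may be extended to all
        \<open>S\<close> blocks.\<close>
      also have "\<dots> \<le> (\<Prod>g<S. \<Prod>l<b. f u g l)"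
        using kap_le_S[of u "lev u"] u lev_le[OF u] f1
        by (intro prod_mono2) (auto intro!: prod_ge_1 intro: order_trans[OF zero_le_one])
      also have "\<dots> \<le> (\<Prod>g<S. (18 * jump_size u (\<sigma> g)) ^ b)"
      proof (intro prod_mono conjI)
        fix g
        have "(\<Prod>l\<in>{..<b}. f u g l) \<le> ((\<Sum>l<b. f u g l) / card {..<b}) ^ card {..<b}"
          by (intro prod_le_mean_power) (auto intro: less_le_trans[OF _ f1])
        also have "(\<Sum>l<b. f u g l) / card {..<b} = 18 * jump_size u (\<sigma> g)"
          using b_pos by (simp add: f_def jump_size_def rms_power2 field_simps sum.distrib sum_distrib_left)
        finally show "(\<Prod>l<b. f u g l) \<le> (18 * jump_size u (\<sigma> g)) ^ b"
          by simp
      qed (auto intro!: prod_nonneg intro: order_trans[OF zero_le_one f1])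
      also have "\<dots> = (18 ^ S * (\<Prod>g<S. jump_size u (\<sigma> g))) ^ b"
        by (simp add: prod.distrib prod_power_distrib power_mult_distrib power_commutes flip: power_mult)
      also have "\<dots> \<le> (18 ^ S * 10 ^ S) ^ b"
        using assms u by (intro power_mono mult_left_mono) (auto simp: small_jumps_def jump_size_def intro!: prod_nonneg mult_nonneg_nonneg)
      \<comment> \<open>The base 180 = 18 * 10 combines the constant of \<open>diff_bound\<close>
        with that of \<open>small_jumps\<close>.\<close>
      also have "\<dots> = 180 ^ (b * S)"
        by (simp add: mult.commute[of b] power_mult flip: power_mult_distrib)
      finally show "(\<Prod>s\<le>H. \<Prod>j\<in>{..<kap (u, s)} \<times> {..<b}. a ((u, s), j)) \<le> 180 ^ (b * S)" .
    qed (auto simp: a_def intro!: prod_nonneg intro: order_trans[OF zero_le_one f1])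
    finally show "(\<Prod>i\<in>idx n H b kap. a i) \<le> (180 ^ (b * S)) ^ n"
      by simp
  qed (auto simp: a_def intro!: prod_nonneg intro: order_trans[OF zero_le_one f1])
  finally show ?thesis
    by (simp add: max_weight_def)
qed

lemma state_in_states:
  assumes "\<sigma> \<in> coins" "small_jumps \<sigma>"
  shows "state \<sigma> \<in> states"
proof -
  have "diff \<sigma> \<in> diffs kap"
    using diff_weight[OF assms(2)] by (auto simp: diffs_def diff_def)
  then show ?thesis
    using assms(1) T.lev_PiE T.par_PiE kap_in_kappas by (simp add: states_def state_def)
qed

end

section \<open>Correctness\<close>

lemma sum_half_powers_le: "(\<Sum>\<kappa>\<in>{k..m}. 1 / 2 ^ \<kappa>) \<le> 2 / (2 :: real) ^ k"
proof -
  have "(\<Sum>\<kappa>\<in>{k..m}. 1 / 2 ^ \<kappa>) \<le> 2 / (2 :: real) ^ k - 1 / 2 ^ m" if "k \<le> m"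
    using that
  proof (induction rule: dec_induct)
    case (step m)
    have "1 / (2 :: real) ^ Suc m = 1 / 2 ^ m / 2"
      by simp
    with step show ?case
      by simp
  qed simp
  then show ?thesis
    by (cases "k \<le> m") (auto intro: order_trans)
qed

context sketch_points
begin

definition rank :: "point \<Rightarrow> nat \<Rightarrow> nat" where
  "rank y u = card {i \<in> {1..n}. edist d (X i) y \<le> edist d (X u) y}"

definition bad_blocks :: "point \<Rightarrow> nat \<Rightarrow> (nat \<times> nat \<Rightarrow> real) set" where
  "bad_blocks y u = {\<rho> \<in> block. \<not> \<bar>rms b (\<lambda>l. srow d \<rho> l (\<lambda>k. rv (X u) k - rv y k)) - edist d (X u) y\<bar>
     \<le> \<epsilon> / 8 * edist d (X u) y}"

text \<open>The number of blocks stored at a node depends on its level, which is unknown here.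
  Asking for every \<kappa> from \<open>kap0 (rank y u)\<close> on makes the event independent of
  the level and costs only a geometric series.\<close>

definition good_majorities :: "point \<Rightarrow> (nat \<Rightarrow> nat \<times> nat \<Rightarrow> real) \<Rightarrow> bool" where
  "good_majorities y \<sigma> \<longleftrightarrow> (\<forall>u\<in>{1..n}. \<forall>\<kappa>\<in>{kap0 (rank y u)..S}. 2 * card {g. g < \<kappa> \<and> \<sigma> g \<in> bad_blocks y u} < \<kappa>)"

lemma rank_pos: "u \<in> {1..n} \<Longrightarrow> 1 \<le> rank y u"
proof -
  assume "u \<in> {1..n}"
  then have "card {u} \<le> rank y u"
    unfolding rank_def by (intro card_mono) auto
  then show ?thesis
    by simp
qed

text \<open>Points closer to \<open>y\<close> than \<open>u\<close> lie in the ball around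
  \<open>u\<close>, so the node stores at least \<open>kap0 (rank y u)\<close> blocks and most of
  them are good. A good block errs by \<epsilon>/8 times the distance, plus \<open>r s\<close> for
  the rounding.\<close>

lemma level_estimate_close:
  assumes \<sigma>: "\<sigma> \<in> coins" "good_majorities y \<sigma>" and i: "i \<in> {1..n}" and s: "s \<le> H"
  defines "D \<equiv> edist d (X (anc lev par s i)) y" and "v \<equiv> level_estimate (state \<sigma>) (rv y) i s"
  assumes close: "2 * D \<le> A * r s"
  shows "\<bar>v - D\<bar> \<le> \<epsilon> / 8 * (v + D) + 2 * r s \<and> 0 \<le> v"
proof -
  define u where "u = anc lev par s i"
  define K where "K = kap (u, s)"
  define e where "e = (\<lambda>g. rms b (\<lambda>l. r s * dpos lev par H (diff \<sigma>) (H - s) u (g, l) - srow d (\<sigma> g) l (rv y)))"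
  have uN: "u \<in> N s"
    unfolding u_def by (rule T.anc_mem(1)[OF i s])
  then have u: "u \<in> {1..n}"
    using T.N_subset_V by blast
  have K: "K = kap0 (T.ball_size A u s)" "K \<le> S"
    using kap_eq[OF uN s] kap_le_S[of u s] u s by (auto simp: K_def)
  have "{i \<in> {1..n}. edist d (X i) y \<le> edist d (X u) y} \<subseteq> {i \<in> {1..n}. edist d (X i) (X u) \<le> A * r s}"
  proof safe
    fix i assume "edist d (X i) y \<le> edist d (X u) y"
    then show "edist d (X i) (X u) \<le> A * r s"
      using edist_triangle[of d "X i" "X u" y] edist_commute[of d y "X u"] close by (simp add: D_def u_def)
  qed
  then have "rank y u \<le> T.ball_size A u s"
    unfolding rank_def T.ball_size_def by (intro card_mono) auto
  then have "kap0 (rank y u) \<le> K"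
    using kap0_mono[OF rank_pos[OF u]] K by simp
  with K \<sigma>(2) u have minority: "2 * card {g. g < K \<and> \<sigma> g \<in> bad_blocks y u} < K"
    by (simp add: good_majorities_def)
  have block: "\<bar>e g - D\<bar> \<le> \<epsilon> / 8 * D + r s" if g: "g < K" "\<sigma> g \<notin> bad_blocks y u" for g
  proof -
    have "\<bar>rms b (\<lambda>l. srow d (\<sigma> g) l (\<lambda>k. rv (X u) k - rv y k)) - D\<bar> \<le> \<epsilon> / 8 * D"
    proof -
      have "\<sigma> g \<in> block"
        using PiE_mem[of \<sigma> "{..<S}" "\<lambda>_. block" g] g(1) K(2) \<sigma>(1) by (simp only: coins_def lessThan_iff)
      with g(2) show ?thesis
        by (simp only: bad_blocks_def D_def u_def mem_Collect_eq) simp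
    qed
    moreover have "\<bar>e g - rms b (\<lambda>l. srow d (\<sigma> g) l (\<lambda>k. rv (X u) k - rv y k))\<bar> \<le> r s"
      unfolding e_def
    proof (rule rms_perturb)
      fix l assume "l < b"
      then have "dpos lev par H (diff \<sigma>) (H - s) u (g, l) = \<lfloor>srow d (\<sigma> g) l (rv (X u)) / r s\<rfloor>"
        using dpos_eq[of "H - s" u g l] s uN g(1) by (simp add: K_def pos_def)
      moreover have "\<bar>r s * real_of_int \<lfloor>z / r s\<rfloor> - z\<bar> \<le> r s" for z
      proof -
        have "\<bar>real_of_int \<lfloor>z / r s\<rfloor> - z / r s\<bar> \<le> 1"
          by linarith
        then have "r s * \<bar>real_of_int \<lfloor>z / r s\<rfloor> - z / r s\<bar> \<le> r s * 1"
          using r_pos[of s] by (intro mult_left_mono) auto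
        also have "r s * \<bar>real_of_int \<lfloor>z / r s\<rfloor> - z / r s\<bar> = \<bar>r s * (real_of_int \<lfloor>z / r s\<rfloor> - z / r s)\<bar>"
          using r_pos[of s] by (simp add: abs_mult)
        also have "r s * (real_of_int \<lfloor>z / r s\<rfloor> - z / r s) = r s * real_of_int \<lfloor>z / r s\<rfloor> - z"
          using r_pos[of s] by (simp add: right_diff_distrib)
        finally show ?thesis
          by simp
      qed
      ultimately show "\<bar>r s * real_of_int (dpos lev par H (diff \<sigma>) (H - s) u (g, l)) - srow d (\<sigma> g) l (rv y)
          - srow d (\<sigma> g) l (\<lambda>k. rv (X u) k - rv y k)\<bar> \<le> r s"
        by (simp add: srow_diff)
    qed (use r_pos[of s] in simp)
    ultimately show ?thesis
      by linarith
  qed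
  have "{..<K} = {g. g < K \<and> \<sigma> g \<in> bad_blocks y u} \<union> {g. g < K \<and> \<sigma> g \<notin> bad_blocks y u}"
    by auto
  then have "card {..<K} = card {g. g < K \<and> \<sigma> g \<in> bad_blocks y u} + card {g. g < K \<and> \<sigma> g \<notin> bad_blocks y u}"
    by (simp only:) (rule card_Un_disjoint; auto)
  moreover have "card {g. g < K \<and> \<sigma> g \<notin> bad_blocks y u} \<le> card {g. g < K \<and> \<bar>e g - D\<bar> \<le> \<epsilon> / 8 * D + r s}"
    using block by (intro card_mono) auto
  ultimately have "K < 2 * card {g. g < K \<and> \<bar>e g - D\<bar> \<le> \<epsilon> / 8 * D + r s}"
    using minority unfolding card_lessThan by linarith
  moreover have "v = majority_value K e (\<epsilon> / 8) (r s)"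
    by (simp add: v_def level_estimate_def state_def Let_def K_def e_def u_def)
  ultimately show ?thesis
    using majority_value_close[of D K e "\<epsilon> / 8" "r s"] by (simp add: D_def edist_nonneg)
qed

lemma decode_state:
  assumes \<sigma>: "\<sigma> \<in> coins" "good_majorities (Y j) \<sigma>" and i: "i \<in> {1..n}" and Y: "Y j \<in> grid d \<Phi>"
  shows "(1 - \<epsilon>) * edist d (X i) (Y j) \<le> decode (state \<sigma>) Y i j \<and>
    decode (state \<sigma>) Y i j \<le> (1 + \<epsilon>) * edist d (X i) (Y j)"
proof -
  define Ds where "Ds = (\<lambda>s. edist d (X (anc lev par s i)) (Y j))"
  have "(1 - \<epsilon>) * Ds 0 \<le> decode (state \<sigma>) Y i j \<and> decode (state \<sigma>) Y i j \<le> (1 + \<epsilon>) * Ds 0"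
    unfolding decode_def Let_def
  proof (rule threshold_estimate [OF \<epsilon> \<theta>_def r_0 r_Suc])
    fix s assume "s \<le> H" "2 * Ds s \<le> 8 * \<theta> * r s"
    then show "\<bar>level_estimate (state \<sigma>) (rv (Y j)) i s - Ds s\<bar> \<le>
        \<epsilon> / 8 * (level_estimate (state \<sigma>) (rv (Y j)) i s + Ds s) + 2 * r s \<and>
        0 \<le> level_estimate (state \<sigma>) (rv (Y j)) i s"
      using level_estimate_close[OF \<sigma> i, of s] by (simp add: Ds_def A_def)
  next
    fix s assume s: "s \<le> H"
    have "edist d (X i) (X (anc lev par s i)) \<le> 2 * r s"
      by (rule T.anc_mem(2)[OF i s])
    then show "\<bar>Ds s - Ds 0\<bar> \<le> 2 * r s"
      using edist_triangle[of d "X i" "Y j" "X (anc lev par s i)"]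
        edist_triangle[of d "X (anc lev par s i)" "Y j" "X i"]
        edist_commute[of d "X i" "X (anc lev par s i)"] by (simp add: Ds_def abs_le_iff)
  next
    fix s assume s: "s < H"
    then have "edist d (X (anc lev par s i)) (X (anc lev par (Suc s) i)) \<le> r (Suc s)"
      using T.nx_mem(2)[OF T.anc_mem(1)[OF i, of s] s] by simp
    then show "Ds s \<le> Ds (Suc s) + r (Suc s)"
      using edist_triangle[of d "X (anc lev par s i)" "Y j" "X (anc lev par (Suc s) i)"] by (simp add: Ds_def)
  next
    \<comment> \<open>All inputs lie in a common ball of radius \<open>r H\<close>, so the top level
      is always reliable.\<close>
    have "anc lev par H i \<in> {1..n}"
      using T.anc_mem(1)[OF i, of H] T.N_subset_V by blast
    then have "Ds H \<le> 2 * r H"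
      using edist_grid_le[OF X_grid Y] d\<Phi>_le_r_H by (force simp: Ds_def)
    moreover have "320 * r H \<le> A * r H"
      using A_ge r_pos[of H] by (intro mult_right_mono) auto
    ultimately show "2 * Ds H \<le> 8 * \<theta> * r H"
      using r_pos[of H] unfolding A_def by linarith
  qed (auto simp: Ds_def edist_nonneg edist_less_1)
  then show ?thesis
    by (simp add: Ds_def)
qed

text \<open>A point of rank m fails with probability at most 2 * 2^-kap0 m \<le> \<delta>/(4 q m^2).
  By \<open>sum_rank_le\<close> the ranks may be treated as 1, ..., n, and the sum of 1/m^2 is at
  most 2.\<close>

lemma card_bad_majorities:
  "real (card {\<sigma> \<in> coins. \<not> good_majorities y \<sigma>}) \<le> card coins * (\<delta> / (2 * q))"
proof -
  define F where "F = (\<lambda>u \<kappa>. {\<sigma> \<in> coins. \<kappa> \<le> 2 * card {g. g < \<kappa> \<and> \<sigma> g \<in> bad_blocks y u}})"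
  define f where "f = (\<lambda>m. \<delta> / (4 * q) * (1 / (real m)\<^sup>2))"
  have F: "real (card (F u \<kappa>)) \<le> card coins * (1 / 2 ^ \<kappa>)" if "\<kappa> \<le> S" for u \<kappa>
  proof -
    have "16 * card (bad_blocks y u) \<le> card block"
      unfolding bad_blocks_def edist_rv
      by (rule rms_row_chebyshev) (use \<epsilon> b_pos b_ge in \<open>auto simp: field_simps\<close>)
    then have "2 ^ \<kappa> * card (F u \<kappa>) \<le> card coins"
      unfolding F_def coins_def using that by (intro card_majority_fails) (auto simp: bad_blocks_def)
    then have "real (2 ^ \<kappa> * card (F u \<kappa>)) \<le> real (card coins)"
      by (rule of_nat_mono)
    then show ?thesis
      by (simp add: field_simps)
  qed
  have f_bound: "2 / 2 ^ kap0 m \<le> f m" if "1 \<le> m" for m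
  proof -
    have "0 < 8 * q * (real m)\<^sup>2 / \<delta>"
      using q \<delta> that by simp
    then have "2 / 2 ^ kap0 m \<le> 2 / (8 * q * (real m)\<^sup>2 / \<delta>)"
      using kap0_power[OF that] by (intro divide_left_mono mult_pos_pos) auto
    then show ?thesis
      by (simp add: f_def field_simps)
  qed
  have "{\<sigma> \<in> coins. \<not> good_majorities y \<sigma>} = (\<Union>u\<in>{1..n}. \<Union>\<kappa>\<in>{kap0 (rank y u)..S}. F u \<kappa>)"
    by (auto simp: good_majorities_def F_def not_less)
  then have "card {\<sigma> \<in> coins. \<not> good_majorities y \<sigma>} \<le> (\<Sum>u\<in>{1..n}. card (\<Union>\<kappa>\<in>{kap0 (rank y u)..S}. F u \<kappa>))"
    by (simp only: card_UN_le finite_atLeastAtMost)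
  also have "\<dots> \<le> (\<Sum>u\<in>{1..n}. \<Sum>\<kappa>\<in>{kap0 (rank y u)..S}. card (F u \<kappa>))"
    by (intro sum_mono card_UN_le) simp
  finally have "real (card {\<sigma> \<in> coins. \<not> good_majorities y \<sigma>})
      \<le> (\<Sum>u\<in>{1..n}. \<Sum>\<kappa>\<in>{kap0 (rank y u)..S}. real (card (F u \<kappa>)))"
    by (simp flip: of_nat_sum)
  also have "\<dots> \<le> (\<Sum>u\<in>{1..n}. \<Sum>\<kappa>\<in>{kap0 (rank y u)..S}. card coins * (1 / 2 ^ \<kappa>))"
    by (intro sum_mono F) auto
  also have "\<dots> = card coins * (\<Sum>u\<in>{1..n}. \<Sum>\<kappa>\<in>{kap0 (rank y u)..S}. 1 / 2 ^ \<kappa>)"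
    by (simp add: sum_distrib_left)
  also have "\<dots> \<le> card coins * (\<Sum>u\<in>{1..n}. f (rank y u))"
    by (intro mult_left_mono sum_mono order_trans[OF sum_half_powers_le f_bound] rank_pos) auto
  also have "\<dots> \<le> card coins * (\<Sum>m=1..n. f m)"
  proof (intro mult_left_mono)
    have "f m \<le> f k" if "1 \<le> k" "k \<le> m" for k m
      unfolding f_def using that \<delta> q by (intro mult_left_mono divide_left_mono power_mono) auto
    from sum_rank_le[OF finite_atLeastAtMost[of 1 n] this, where val = "\<lambda>u. edist d (X u) y"]
    show "(\<Sum>u\<in>{1..n}. f (rank y u)) \<le> (\<Sum>m=1..n. f m)"
      by (simp add: rank_def)
  qed simp
  also have "(\<Sum>m=1..n. f m) = \<delta> / (4 * q) * (\<Sum>m=1..n. 1 / (real m)\<^sup>2)"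
    by (simp only: f_def sum_distrib_left)
  also have "\<dots> \<le> \<delta> / (4 * q) * 2"
    using \<delta> by (intro mult_left_mono sum_inverse_squares_le) auto
  also have "\<dots> = \<delta> / (2 * q)"
    by simp
  finally show ?thesis
    by (simp add: mult_left_mono)
qed

text \<open>A union bound over the \<open>n\<close> points, each failing with probability at most
  2^-S, where \<open>S = kap0 n\<close>.\<close>

lemma card_not_small_jumps: "real (card {\<sigma> \<in> coins. \<not> small_jumps \<sigma>}) \<le> card coins * (\<delta> / 8)"
proof -
  define F where "F = (\<lambda>u. {\<sigma> \<in> coins. 10 ^ S < (\<Prod>g<S. jump_size u (\<sigma> g))})"
  have F: "real (card (F u)) \<le> card coins * (1 / 2 ^ S)" if "u \<in> {1..n}" for u
  proof -
    have "real (2 ^ S * card (F u)) \<le> real (card coins)"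
      unfolding F_def by (intro of_nat_mono card_large_jump that)
    then show ?thesis
      by (simp add: field_simps)
  qed
  have "{\<sigma> \<in> coins. \<not> small_jumps \<sigma>} = (\<Union>u\<in>{1..n}. F u)"
    by (auto simp: small_jumps_def F_def not_le)
  then have "card {\<sigma> \<in> coins. \<not> small_jumps \<sigma>} \<le> (\<Sum>u\<in>{1..n}. card (F u))"
    by (simp only: card_UN_le finite_atLeastAtMost)
  then have "real (card {\<sigma> \<in> coins. \<not> small_jumps \<sigma>}) \<le> (\<Sum>u\<in>{1..n}. real (card (F u)))"
    by (simp flip: of_nat_sum)
  also have "\<dots> \<le> (\<Sum>u\<in>{1..n}. card coins * (1 / 2 ^ S))"
    by (intro sum_mono F)
  also have "\<dots> = card coins * (n / 2 ^ S)"
    by simp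
  also have "\<dots> \<le> card coins * (\<delta> / 8)"
  proof (intro mult_left_mono)
    have "8 * real n / \<delta> \<le> 8 * q * (real n)\<^sup>2 / \<delta>"
      using n_pos q(1) \<delta> mult_mono[of 1 "real q" 1 "real n"] by (intro divide_right_mono) (auto simp: power2_eq_square)
    also have "\<dots> \<le> 2 ^ S"
      using kap0_power[OF n_pos] by (simp add: S_def)
    finally show "n / 2 ^ S \<le> \<delta> / 8"
      using \<delta> by (simp add: field_simps)
  qed simp
  finally show ?thesis .
qed

text \<open>The failures add up to \<delta>/8 for large jumps and \<delta>/(2q) for each of the
  \<open>q\<close> queries, in total less than \<delta>.\<close>

lemma card_good_coins:
  assumes Y: "Y \<in> inputs q d \<Phi>"
  shows "(1 - \<delta>) * card coins \<le> card {\<sigma>\<in>coins. state \<sigma> \<in> states \<and> (\<forall>i\<in>{1..n}. \<forall>j\<in>{1..q}.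
    (1 - \<epsilon>) * edist d (X i) (Y j) \<le> decode (state \<sigma>) Y i j \<and>
    decode (state \<sigma>) Y i j \<le> (1 + \<epsilon>) * edist d (X i) (Y j))}" (is "_ \<le> real (card ?G)")
proof -
  define B1 where "B1 = {\<sigma> \<in> coins. \<not> small_jumps \<sigma>}"
  define B2 where "B2 = (\<lambda>j. {\<sigma> \<in> coins. \<not> good_majorities (Y j) \<sigma>})"
  have "coins \<subseteq> ?G \<union> B1 \<union> (\<Union>j\<in>{1..q}. B2 j)"
  proof
    fix \<sigma> assume \<sigma>: "\<sigma> \<in> coins"
    have grid: "Y j \<in> grid d \<Phi>" if "j \<in> {1..q}" for j
      using Y that by (auto simp: inputs_def)
    show "\<sigma> \<in> ?G \<union> B1 \<union> (\<Union>j\<in>{1..q}. B2 j)"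
    proof (cases "small_jumps \<sigma> \<and> (\<forall>j\<in>{1..q}. good_majorities (Y j) \<sigma>)")
      case True
      then have good: "good_majorities (Y j) \<sigma>" if "j \<in> {1..q}" for j
        using that by blast
      have "(1 - \<epsilon>) * edist d (X i) (Y j) \<le> decode (state \<sigma>) Y i j \<and>
          decode (state \<sigma>) Y i j \<le> (1 + \<epsilon>) * edist d (X i) (Y j)"
        if "i \<in> {1..n}" "j \<in> {1..q}" for i j
        by (rule decode_state[of \<sigma> Y j i, OF \<sigma> good[OF that(2)] that(1) grid[OF that(2)]])
      then have "\<sigma> \<in> ?G"
        using state_in_states[OF \<sigma>] True \<sigma> by simp
      then show ?thesis
        by (intro UnI1)
    next
      case False
      then show ?thesis
        using \<sigma> unfolding B1_def B2_def by (simp del: atLeastAtMost_iff)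
    qed
  qed
  then have "card coins \<le> card (?G \<union> B1 \<union> (\<Union>j\<in>{1..q}. B2 j))"
    using finite_coins by (intro card_mono) (auto simp: B1_def B2_def)
  also have "\<dots> \<le> card (?G \<union> B1) + card (\<Union>j\<in>{1..q}. B2 j)"
    by (rule card_Un_le)
  also have "\<dots> \<le> (card ?G + card B1) + (\<Sum>j\<in>{1..q}. card (B2 j))"
    by (intro add_mono card_Un_le card_UN_le finite_atLeastAtMost)
  finally have "real (card coins) \<le> real (card ?G) + real (card B1) + (\<Sum>j\<in>{1..q}. real (card (B2 j)))"
    by (simp flip: of_nat_sum of_nat_add)
  also have "\<dots> \<le> real (card ?G) + card coins * (\<delta> / 8) + (\<Sum>j\<in>{1..q}. card coins * (\<delta> / (2 * q)))"
    unfolding B1_def B2_def by (intro add_mono sum_mono card_not_small_jumps card_bad_majorities order_refl)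
  also have "(\<Sum>j\<in>{1..q}. card coins * (\<delta> / (2 * q))) = card coins * (\<delta> / 2)"
    using q by simp
  finally have "card coins * (1 - \<delta> / 8 - \<delta> / 2) \<le> card ?G"
    by (simp add: algebra_simps)
  moreover have "(1 - \<delta>) * card coins \<le> card coins * (1 - \<delta> / 8 - \<delta> / 2)"
    using \<delta> by (subst mult.commute) (intro mult_left_mono, auto)
  ultimately show ?thesis
    by linarith
qed

end

context sketch
begin

text \<open>The state is chosen before \<open>Y\<close> is quantified, as Alice does not know the
  queries.\<close>

lemma ex_state:
  assumes X: "X \<in> inputs n d \<Phi>"
  shows "\<exists>st. \<forall>Y\<in>inputs q d \<Phi>. (1 - \<delta>) * card coins \<le> card {\<sigma>\<in>coins. st \<sigma> \<in> states \<and>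
    (\<forall>i\<in>{1..n}. \<forall>j\<in>{1..q}. (1 - \<epsilon>) * edist d (X i) (Y j) \<le> decode (st \<sigma>) Y i j \<and>
      decode (st \<sigma>) Y i j \<le> (1 + \<epsilon>) * edist d (X i) (Y j))}"
proof -
  have "\<exists>lev par N. net_tree {1..n} (\<lambda>u v. edist d (X u) (X v)) r H lev par N"
    by (rule ex_net_tree) (simp_all add: edist_commute edist_triangle r_pos r_Suc)
  then obtain lev par N where tree: "net_tree {1..n} (\<lambda>u v. edist d (X u) (X v)) r H lev par N"
    by blast
  interpret sketch_points n q d \<Phi> \<epsilon> \<delta> X lev par N
    by (rule sketch_points.intro[OF sketch_axioms sketch_points_axioms.intro[OF X tree]])
  show ?thesis
    using card_good_coins by blast
qed

lemma ex_protocol: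
  assumes "real (card states) \<le> 2 powr B" "0 \<le> B"
  shows "\<exists>A C. solves_all_cross_distances n q d \<Phi> \<epsilon> \<delta> A C \<and> sketch_size_at_most n d \<Phi> A (B + 1)"
proof -
  define good where "good = (\<lambda>X st. \<forall>Y\<in>inputs q d \<Phi>. (1 - \<delta>) * card coins \<le> card {\<sigma>\<in>coins. st \<sigma> \<in> states \<and>
    (\<forall>i\<in>{1..n}. \<forall>j\<in>{1..q}. (1 - \<epsilon>) * edist d (X i) (Y j) \<le> decode (st \<sigma>) Y i j \<and>
      decode (st \<sigma>) Y i j \<le> (1 + \<epsilon>) * edist d (X i) (Y j))})"
  have "\<forall>X\<in>inputs n d \<Phi>. \<exists>st. good X st"
    unfolding good_def by (intro ballI ex_state)
  from bchoice[OF this] obtain st where st: "\<forall>X\<in>inputs n d \<Phi>. good X (st X)"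
    by (rule exE)
  have nonempty: "coins \<noteq> {}"
    using card_coins by auto
  show ?thesis
    by (rule protocol_of_states[OF finite_coins nonempty finite_states assms,
          where S = "\<lambda>\<sigma> X. st X \<sigma>" and dec = decode])
      (rule bspec[OF bspec[OF st, unfolded good_def]])
qed

end

section \<open>Size\<close>

lemma logf_ge: "1 \<le> logf x" "log 2 x \<le> logf x"
  by (simp_all add: logf_def)

context sketch
begin

lemma card_states_powr:
  "real (card states) \<le>
    2 powr (real S * b * d + n * log 2 n + 2 * n * (H + 1) + kap_total + 4 * b * kap_total + 8 * b * S * n)"
proof -
  \<comment> \<open>This crude bound for \<open>lev\<close> costs no more than the term
    \<open>n * (H + 1)\<close> already spent on encoding \<kappa>.\<close>
  have "(H + 1) ^ n \<le> (2 ^ (H + 1)) ^ n"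
    by (intro power_mono less_imp_le less_exp) simp
  also have "\<dots> = 2 ^ (n * (H + 1))"
    by (simp only: power_mult [symmetric] mult.commute)
  finally have "real ((H + 1) ^ n) \<le> real (2 ^ (n * (H + 1)))"
    by (rule of_nat_mono)
  then have H: "real ((H + 1) ^ n) \<le> 2 ^ (n * (H + 1))"
    by (simp only: of_nat_power of_nat_numeral)
  have "real (n ^ n) = (2 powr log 2 n) powr n"
    using n_pos by (simp add: powr_realpow)
  then have n: "real (n ^ n) = 2 powr (n * log 2 n)"
    by (simp add: powr_powr mult.commute)
  have "(180 ^ (b * S)) ^ n \<le> ((256::real) ^ (b * S)) ^ n"
    by (intro power_mono) auto
  also have "(256::real) = 2 ^ 8"
    by simp
  finally have w: "max_weight \<le> 2 ^ (2 * b * kap_total) * 2 ^ (8 * b * S * n)"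
    unfolding max_weight_def by (intro mult_mono) (simp_all add: power_mult mult.assoc)
  have "real (card states) \<le> 2 ^ (S * (b * d)) * (H + 1) ^ n * n ^ n *
      2 ^ (kap_total + n * (H + 1)) * (max_weight * 4 ^ (b * kap_total))"
    by (rule card_states)
  also have "\<dots> = 2 ^ (S * (b * d)) * real ((H + 1) ^ n) * real (n ^ n) *
      2 ^ (kap_total + n * (H + 1)) * (max_weight * 2 ^ (2 * b * kap_total))"
    by (simp add: power_mult)
  also have "\<dots> \<le> 2 ^ (S * (b * d)) * 2 ^ (n * (H + 1)) * 2 powr (n * log 2 n) *
      2 ^ (kap_total + n * (H + 1)) * ((2 ^ (2 * b * kap_total) * 2 ^ (8 * b * S * n)) * 2 ^ (2 * b * kap_total))"
    using n by (intro mult_mono mult_nonneg_nonneg H w max_weight_nonneg order_refl) auto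
  also have "\<dots> = 2 powr (real S * b * d + n * log 2 n + 2 * n * (H + 1) + kap_total + 4 * b * kap_total + 8 * b * S * n)"
    by (simp flip: powr_realpow powr_add) (simp add: algebra_simps)
  finally show ?thesis .
qed

text \<open>The assumption d > 1/\<epsilon>^2 bounds log (1/\<epsilon>) by log (d \<Phi>). Hence
  \<open>H\<close> is of order log (d \<Phi>), and the product of \<open>e\<close> and \<mu> that
  arises from crowded nodes is absorbed by \<Lambda> \<mu>.\<close>

lemma states_bound:
  assumes n2: "2 \<le> n" and d\<epsilon>: "1 / \<epsilon>\<^sup>2 < d"
  defines "W \<equiv> log 2 n * logf (1 / \<epsilon>) + log 2 (real d * real \<Phi>) * logf (q / \<delta>)"
  shows "real S * b * d + n * log 2 n + 2 * n * (H + 1) + kap_total + 4 * b * kap_total + 8 * b * S * n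
    \<le> 1900000 * (n / \<epsilon>\<^sup>2 * W + (real d ^ 3 + (real d)\<^sup>2 * log 2 (q / \<delta>)))"
proof -
  define \<nu> e \<Lambda> \<mu> where "\<nu> = log 2 n" and "e = logf (1 / \<epsilon>)"
    and "\<Lambda> = log 2 (real d * real \<Phi>)" and "\<mu> = logf (q / \<delta>)"
  define M where "M = n / \<epsilon>\<^sup>2 * W"
  have W: "W = \<nu> * e + \<Lambda> * \<mu>"
    by (simp add: W_def \<nu>_def e_def \<Lambda>_def \<mu>_def)
  have \<epsilon>2: "\<epsilon>\<^sup>2 \<le> \<epsilon>" "\<epsilon>\<^sup>2 > 0" "1 \<le> 1 / \<epsilon>\<^sup>2"
    using \<epsilon> by (simp_all add: power2_eq_square mult_le_one)
  have \<nu>: "1 \<le> \<nu>"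
    using n2 by (simp add: \<nu>_def le_log_iff)
  have e: "1 \<le> e" and \<mu>: "1 \<le> \<mu>"
    by (simp_all add: e_def \<mu>_def logf_ge)
  have "1 < real d"
    using d\<epsilon> \<epsilon>2(3) by linarith
  then have d2: "2 \<le> real d"
    by simp
  have "real d * 1 \<le> real d * real \<Phi>"
    using \<Phi> by (intro mult_left_mono) auto
  then have d\<Phi>: "real d \<le> real d * real \<Phi>"
    by simp
  have d\<Phi>2: "2 \<le> real d * real \<Phi>"
    using d2 d\<Phi> by linarith
  then have \<Lambda>: "1 \<le> \<Lambda>"
    by (simp add: \<Lambda>_def le_log_iff)
  have "1 / \<epsilon> \<le> 1 / \<epsilon>\<^sup>2"
    using \<epsilon> \<epsilon>2 by (intro divide_left_mono mult_pos_pos \<epsilon>(1)) simp_all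
  then have "1 / \<epsilon> \<le> real d * real \<Phi>"
    using d\<epsilon> d\<Phi> by linarith
  then have "log 2 (1 / \<epsilon>) \<le> \<Lambda>"
    unfolding \<Lambda>_def using \<epsilon> d \<Phi> by (subst log_le_cancel_iff) auto
  then have e\<Lambda>: "e \<le> \<Lambda>"
    using \<Lambda> by (simp add: e_def logf_def)
  have prod: "\<nu> \<le> \<nu> * e" "\<Lambda> \<le> \<Lambda> * \<mu>" "\<mu> \<le> \<Lambda> * \<mu>" "e * \<mu> \<le> \<Lambda> * \<mu>"
    using \<nu> e \<Lambda> \<mu> e\<Lambda> by (simp_all add: mult_right_mono)
  have nonneg: "0 \<le> \<nu> * e" "0 \<le> \<Lambda> * \<mu>"
    using \<nu> e \<Lambda> \<mu> by simp_all
  have W0: "0 \<le> W"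
    using nonneg by (simp add: W)
  have le_W: "\<nu> \<le> W" "\<Lambda> \<le> W"
    by (rule order_trans[OF prod(1)], use nonneg in \<open>simp add: W\<close>)
      (rule order_trans[OF prod(2)], use nonneg in \<open>simp add: W\<close>)
  have scale: "real n * W \<le> M"
    using mult_right_mono[OF \<epsilon>2(3), of "real n * W"] W0 by (simp add: M_def)
  have H: "real (H + 1) \<le> 11 * \<Lambda>"
  proof -
    have "\<epsilon> \<le> 80 * (real d * real \<Phi>)"
      using d\<Phi>2 \<epsilon> by linarith
    then have "0 \<le> log 2 (80 * (real d * real \<Phi>) / \<epsilon>)"
      using \<epsilon> by (simp add: le_divide_eq)
    then have "real H \<le> log 2 (80 * (real d * real \<Phi>) / \<epsilon>) + 1"
      unfolding H_def by linarith
    also have "log 2 (80 * (real d * real \<Phi>) / \<epsilon>) = log 2 80 + \<Lambda> + log 2 (1 / \<epsilon>)"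
      using d \<Phi> \<epsilon> by (simp add: \<Lambda>_def log_mult log_divide)
    also have "log 2 (80::real) \<le> 7"
      by (simp add: log_le_iff)
    finally show ?thesis
      using \<open>log 2 (1 / \<epsilon>) \<le> \<Lambda>\<close> \<Lambda> by simp
  qed
  have c: "real c \<le> 12 * e"
  proof -
    have "1 \<le> 640 / \<epsilon> + 4"
      using \<epsilon> by (simp add: add_nonneg_nonneg)
    then have "0 \<le> log 2 (640 / \<epsilon> + 4)"
      by simp
    then have "real c \<le> log 2 (640 / \<epsilon> + 4) + 1"
      unfolding c_def by linarith
    also have "log 2 (640 / \<epsilon> + 4) \<le> log 2 (1024 * (1 / \<epsilon>))"
      using \<epsilon> by (subst log_le_cancel_iff) (auto simp: field_simps intro!: add_pos_pos)
    also have "\<dots> = log 2 1024 + log 2 (1 / \<epsilon>)"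
      using \<epsilon> by (subst log_mult) auto
    also have "log 2 (1024 :: real) = 10"
      using log_pow_cancel[of "2 :: real" 10] by simp
    finally show ?thesis
      using logf_ge(2)[of "1 / \<epsilon>"] e by (simp add: e_def)
  qed
  have S: "real S \<le> 2 * \<nu> + 5 * \<mu>"
    using kap0_le[OF n_pos] by (simp add: S_def \<nu>_def \<mu>_def)
  then have SW: "real S \<le> 5 * W"
    using prod nonneg by (simp add: W)
  have b: "real b \<le> 2049 * (1 / \<epsilon>\<^sup>2)"
  proof -
    have "0 \<le> 2048 / \<epsilon>\<^sup>2"
      by simp
    then have "real b \<le> 2048 / \<epsilon>\<^sup>2 + 1"
      unfolding b_def by linarith
    then show ?thesis
      using \<epsilon>2(3) by simp
  qed
  \<comment> \<open>The first summand comes from the levels, the second from the crowded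
    nodes.\<close>
  have kap: "real kap_total \<le> 197 * (n * W)"
  proof -
    have "real kap_total \<le> real (H + 1) * ((2 + 5 * \<mu>) * n) + 2 * real c * n * S"
      unfolding kap_total_def \<mu>_def using logf_ge(1)[of "q / \<delta>"] by (intro of_nat_floor add_nonneg_nonneg mult_nonneg_nonneg) auto
    also have "\<dots> \<le> (11 * \<Lambda>) * ((7 * \<mu>) * n) + 2 * (12 * e) * n * (2 * \<nu> + 5 * \<mu>)"
      using H c S \<mu> \<Lambda> e by (intro add_mono mult_mono) auto
    also have "\<dots> = n * (77 * (\<Lambda> * \<mu>) + 48 * (\<nu> * e) + 120 * (e * \<mu>))"
      by (simp add: algebra_simps)
    also have "\<dots> \<le> n * (197 * W)"
      using prod nonneg by (intro mult_left_mono) (auto simp: W)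
    finally show ?thesis
      by simp
  qed
  have bM: "real b * (n * W) \<le> 2049 * M"
    using mult_right_mono[OF b, of "real n * W"] W0 by (simp add: M_def)
  have t1: "4 * b * kap_total \<le> 4 * (197 * (2049 * M))"
  proof -
    have "real b * kap_total \<le> real b * (197 * (n * W))"
      using kap by (intro mult_left_mono) auto
    also have "\<dots> \<le> 197 * (2049 * M)"
      using bM by (simp add: mult_ac)
    finally show ?thesis
      by simp
  qed
  have t2: "8 * b * S * n \<le> 8 * (5 * (2049 * M))"
  proof -
    have "real b * (real S * n) \<le> real b * ((5 * W) * n)"
      using SW by (intro mult_left_mono mult_right_mono) auto
    also have "\<dots> \<le> 5 * (2049 * M)"
      using bM by (simp add: mult_ac)
    finally show ?thesis
      by (simp add: mult_ac)
  qed
  have t3: "n * log 2 n \<le> M"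
  proof -
    have "n * \<nu> \<le> n * W"
      using le_W by (intro mult_left_mono) auto
    with scale show ?thesis
      by (simp add: \<nu>_def)
  qed
  have t4: "2 * n * (H + 1) \<le> 22 * M"
  proof -
    have "real (H + 1) \<le> 11 * W"
      using H le_W by linarith
    then have "n * real (H + 1) \<le> n * (11 * W)"
      by (intro mult_left_mono) auto
    also have "\<dots> = 11 * (n * W)"
      by simp
    finally have "2 * (n * real (H + 1)) \<le> 22 * M"
      using scale by linarith
    then show ?thesis
      by (simp add: algebra_simps)
  qed
  \<comment> \<open>The cost of the sign vectors. For d \<le> n the main term absorbs it; otherwise
    log n \<le> d and \<open>b\<close> is at most 2049 d, so it is polynomial in d and log
    (q/\<delta>).\<close>
  have t5: "real S * b * d \<le> 10245 * M + 14343 * (real d ^ 3 + (real d)\<^sup>2 * log 2 (q / \<delta>))"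
  proof (cases "d \<le> n")
    case True
    have "real S * b * d \<le> (5 * W) * b * n"
      using True SW W0 by (intro mult_mono) auto
    also have "\<dots> = 5 * (real b * (n * W))"
      by simp
    also have "\<dots> \<le> 5 * (2049 * M)"
      using bM by (intro mult_left_mono) auto
    finally show ?thesis
      using log_q_\<delta> by (simp add: add_nonneg_nonneg add_increasing2)
  next
    case False
    have "real b \<le> 2049 * real d"
      using b d\<epsilon> by linarith
    moreover have "\<nu> \<le> real d"
      using log2_of_power_le[of n n] False n_pos less_exp[of n] by (simp add: \<nu>_def)
    moreover have "\<mu> \<le> 1 + log 2 (q / \<delta>)"
      using log_q_\<delta> by (simp add: \<mu>_def logf_def)
    ultimately have "real S * b * d \<le> (2 * real d + 5 * (1 + log 2 (q / \<delta>))) * (2049 * real d) * real d"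
      using S by (intro mult_mono) auto
    also have "\<dots> = 2049 * (2 * real d ^ 3 + 5 * (real d)\<^sup>2 + 5 * ((real d)\<^sup>2 * log 2 (q / \<delta>)))"
      by (simp add: power2_eq_square power3_eq_cube algebra_simps)
    also have "\<dots> \<le> 2049 * (2 * real d ^ 3 + 5 * real d ^ 3 + 5 * ((real d)\<^sup>2 * log 2 (q / \<delta>)))"
      using d by (intro mult_left_mono add_mono order_refl power_increasing) auto
    finally have "real S * b * d \<le> 2049 * (7 * real d ^ 3 + 5 * ((real d)\<^sup>2 * log 2 (q / \<delta>)))"
      by simp
    moreover have "0 \<le> (real d)\<^sup>2 * log 2 (q / \<delta>)" "0 \<le> M"
      using log_q_\<delta> W0 by (simp_all add: M_def)
    ultimately show ?thesis
      by simp
  qed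
  have "0 \<le> real d ^ 3 + (real d)\<^sup>2 * log 2 (q / \<delta>)" "0 \<le> M"
    using log_q_\<delta> W0 by (simp_all add: M_def)
  then show ?thesis
    using t1 t2 t3 t4 t5 kap scale unfolding M_def [symmetric] distrib_left by linarith
qed

section \<open>Exact transmission and the final bound\<close>

lemma ex_exact_protocol:
  "\<exists>A C. solves_all_cross_distances n q d \<Phi> \<epsilon> \<delta> A C \<and>
    sketch_size_at_most n d \<Phi> A (real n * (d * (2 + log 2 \<Phi>)) + 1)"
proof (rule protocol_of_states[of "{()}" "inputs n d \<Phi>" _ n d \<Phi> q \<delta> "\<lambda>_ X. X" \<epsilon> "\<lambda>X Y i j. edist d (X i) (Y j)"])
  have "card {- int \<Phi>..int \<Phi>} = 2 * \<Phi> + 1"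
    unfolding card_atLeastAtMost_int by linarith
  then have grid: "finite (grid d \<Phi>)" "card (grid d \<Phi>) = (2 * \<Phi> + 1) ^ d"
    by (simp_all only: grid_def finite_PiE card_PiE finite_atLeastAtMost finite_atLeastAtMost_int prod_constant card_atLeastAtMost diff_Suc_1)
  then show "finite (inputs n d \<Phi>)"
    by (simp add: inputs_def finite_PiE)
  have "card (inputs n d \<Phi>) = (2 * \<Phi> + 1) ^ (d * n)"
    using grid by (simp add: inputs_def card_PiE power_mult)
  then have "real (card (inputs n d \<Phi>)) = real (2 * \<Phi> + 1) ^ (d * n)"
    by simp
  also have "\<dots> \<le> (4 * real \<Phi>) ^ (d * n)"
    using \<Phi> by (intro power_mono) auto
  also have "4 * real \<Phi> = 2 powr (2 + log 2 \<Phi>)"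
    using \<Phi> by (simp add: powr_add)
  also have "\<dots> ^ (d * n) = 2 powr (real n * (d * (2 + log 2 \<Phi>)))"
    by (simp add: powr_powr mult_ac flip: powr_realpow)
  finally show "real (card (inputs n d \<Phi>)) \<le> 2 powr (real n * (d * (2 + log 2 \<Phi>)))" .
  show "0 \<le> real n * (d * (2 + log 2 \<Phi>))"
    using \<Phi> by (simp add: add_nonneg_nonneg)
  show "(1 - \<delta>) * card {()} \<le> card {\<omega> \<in> {()}. X \<in> inputs n d \<Phi> \<and> (\<forall>i\<in>{1..n}. \<forall>j\<in>{1..q}.
      (1 - \<epsilon>) * edist d (X i) (Y j) \<le> edist d (X i) (Y j) \<and>
      edist d (X i) (Y j) \<le> (1 + \<epsilon>) * edist d (X i) (Y j))}"
    if "X \<in> inputs n d \<Phi>" for X Y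
  proof -
    have "(1 - \<epsilon>) * D \<le> D \<and> D \<le> (1 + \<epsilon>) * D" if "0 \<le> D" for D
      using \<epsilon> that by (simp add: mult_le_cancel_right1 distrib_right left_diff_distrib)
    then show ?thesis
      using that \<delta> by (simp add: edist_nonneg)
  qed
qed simp_all

lemma ex_small_protocol:
  "\<exists>A C. solves_all_cross_distances n q d \<Phi> \<epsilon> \<delta> A C \<and> sketch_size_at_most n d \<Phi> A
     (2000000 * (real n / \<epsilon>\<^sup>2 * (log 2 n * logf (1 / \<epsilon>) + log 2 (real d * real \<Phi>) * logf (q / \<delta>))
       + (real d ^ 3 + (real d)\<^sup>2 * log 2 (q / \<delta>) + real d * log 2 \<Phi>)))"
    (is "\<exists>A C. _ \<and> sketch_size_at_most n d \<Phi> A ?B")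
proof -
  define M where "M = real n / \<epsilon>\<^sup>2 * (log 2 n * logf (1 / \<epsilon>) + log 2 (real d * real \<Phi>) * logf (q / \<delta>))"
  have mono: "\<exists>A C. solves_all_cross_distances n q d \<Phi> \<epsilon> \<delta> A C \<and> sketch_size_at_most n d \<Phi> A y"
    if "\<exists>A C. solves_all_cross_distances n q d \<Phi> \<epsilon> \<delta> A C \<and> sketch_size_at_most n d \<Phi> A x" "x \<le> y" for x y
    using that unfolding sketch_size_at_most_def by (meson order_trans)
  have logs: "0 \<le> log 2 n" "0 \<le> log 2 \<Phi>" "log 2 \<Phi> \<le> log 2 (real d * real \<Phi>)" "0 \<le> log 2 (real d * real \<Phi>)"
    using n_pos d \<Phi> by (auto simp: log_mult)
  have M0: "0 \<le> M"
    unfolding M_def using logs logf_ge(1)[of "1 / \<epsilon>"] logf_ge(1)[of "q / \<delta>"] by simp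
  have p: "1 \<le> real d ^ 3" "real d \<le> real d ^ 3" "0 \<le> (real d)\<^sup>2 * log 2 (q / \<delta>)" "0 \<le> real d * log 2 \<Phi>"
    using d log_q_\<delta> logs self_le_power[of "real d" 3] by simp_all
  have B: "?B = 2000000 * M + 2000000 * real d ^ 3 + 2000000 * ((real d)\<^sup>2 * log 2 (q / \<delta>))
      + 2000000 * (real d * log 2 \<Phi>)"
    by (simp add: M_def distrib_left)
  show ?thesis
  proof (cases "n = 1 \<or> real d \<le> 1 / \<epsilon>\<^sup>2")
    case True
    \<comment> \<open>Exact transmission: for \<open>n = 1\<close> the remainder pays, and for d
      \<le> 1/\<epsilon>^2 the main term does.\<close>
    have "real n * (d * (2 + log 2 \<Phi>)) \<le> 2 * M + (2 * real d + real d * log 2 \<Phi>)"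
    proof (cases "n = 1")
      case True
      then show ?thesis
        using M0 by (simp add: algebra_simps)
    next
      case False
      with \<open>n = 1 \<or> _\<close> have d\<epsilon>: "real d \<le> 1 / \<epsilon>\<^sup>2"
        by simp
      have "1 \<le> log 2 n"
        using False n_pos by (simp add: le_log_iff)
      then have 1: "1 \<le> log 2 n * logf (1 / \<epsilon>)"
        using logf_ge(1)[of "1 / \<epsilon>"] mult_mono[of 1 "log 2 n" 1 "logf (1 / \<epsilon>)"] by simp
      have 2: "log 2 \<Phi> \<le> log 2 (real d * real \<Phi>) * logf (q / \<delta>)"
        using logs logf_ge(1)[of "q / \<delta>"] mult_mono[of "log 2 \<Phi>" "log 2 (real d * real \<Phi>)" 1 "logf (q / \<delta>)"] by simp
      have "real n * (d * (2 + log 2 \<Phi>)) \<le> real n * (1 / \<epsilon>\<^sup>2 *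
          (2 * (log 2 n * logf (1 / \<epsilon>) + log 2 (real d * real \<Phi>) * logf (q / \<delta>))))"
        using d\<epsilon> 1 2 logs by (intro mult_left_mono mult_mono) auto
      also have "\<dots> = 2 * M"
        by (simp add: M_def)
      finally show ?thesis
        using p by simp
    qed
    then have "real n * (d * (2 + log 2 \<Phi>)) + 1 \<le> ?B"
      using p M0 unfolding B by linarith
    then show ?thesis
      by (rule mono[OF ex_exact_protocol])
  next
    case False
    define B where "B = real S * b * d + n * log 2 n + 2 * n * (H + 1) + kap_total + 4 * b * kap_total + 8 * b * S * n"
    have "2 \<le> n" "1 / \<epsilon>\<^sup>2 < d"
      using False n_pos by auto
    then have "B \<le> 1900000 * (M + (real d ^ 3 + (real d)\<^sup>2 * log 2 (q / \<delta>)))"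
      unfolding B_def M_def by (rule states_bound)
    moreover have "x + 1 \<le> 2000000 * M + 2000000 * u + 2000000 * v + 2000000 * w"
      if "x \<le> 1900000 * (M + (u + v))" "1 \<le> u" "0 \<le> v" "0 \<le> w" for x u v w
      using that M0 unfolding distrib_left by linarith
    ultimately have "B + 1 \<le> ?B"
      unfolding B using p by blast
    moreover have "real (card states) \<le> 2 powr B"
      unfolding B_def by (rule card_states_powr)
    moreover have "0 \<le> B"
      unfolding B_def using logs by (intro add_nonneg_nonneg mult_nonneg_nonneg) auto
    ultimately show ?thesis
      using mono[OF ex_protocol] by blast
  qed
qed

end

text \<open>The arguments are d, log \<Phi>, log (q/\<delta>) and log (1/\<epsilon>). The first two
  monomials pay for sign vectors with d > n, the last for a single point sent exactly.\<close>

lemma polynomial4_remainder: "polynomial4 (\<lambda>w x y z. w ^ 3 + w\<^sup>2 * y + w * x)"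
  unfolding polynomial4_def
proof (intro exI allI)
  fix w x y z :: real
  show "w ^ 3 + w\<^sup>2 * y + w * x = (\<Sum>i\<le>(3::nat). \<Sum>j\<le>3. \<Sum>k\<le>3. \<Sum>l\<le>3.
     (if l = 0 then (if i = 3 \<and> j = 0 \<and> k = 0 \<or> i = 2 \<and> j = 0 \<and> k = 1 \<or> i = 1 \<and> j = 1 \<and> k = 0 then 1 else 0) else 0)
       * w ^ i * x ^ j * y ^ k * z ^ l)"
    by (simp add: eval_nat_numeral)
qed

theorem theorem2:
  "\<exists>(C::real) p. C > 0 \<and> polynomial4 p \<and>
     (\<forall>(n::nat) (q::nat) (d::nat) (\<Phi>::nat) (\<epsilon>::real) (\<delta>::real).
        1 \<le> q \<and> q \<le> n \<and> 1 \<le> d \<and> 1 \<le> \<Phi> \<and> 0 < \<epsilon> \<and> \<epsilon> < 1 \<and> 0 < \<delta> \<and> \<delta> < 1 \<longrightarrow>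
        (\<exists>A B. solves_all_cross_distances n q d \<Phi> \<epsilon> \<delta> A B \<and>
           sketch_size_at_most n d \<Phi> A
             (C * (real n / \<epsilon>\<^sup>2 *
                    (log 2 (real n) * logf (1 / \<epsilon>) +
                     log 2 (real d * real \<Phi>) * logf (real q / \<delta>)) +
                   p (real d) (log 2 (real \<Phi>)) (log 2 (real q / \<delta>)) (log 2 (1 / \<epsilon>))))))"
proof (intro exI[of _ "2000000 :: real"] exI[of _ "\<lambda>w x y z. w ^ 3 + w\<^sup>2 * y + w * x"]
    conjI allI impI polynomial4_remainder)
  fix n q d \<Phi> :: nat and \<epsilon> \<delta> :: real
  assume "1 \<le> q \<and> q \<le> n \<and> 1 \<le> d \<and> 1 \<le> \<Phi> \<and> 0 < \<epsilon> \<and> \<epsilon> < 1 \<and> 0 < \<delta> \<and> \<delta> < 1"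
  then interpret sketch n q d \<Phi> \<epsilon> \<delta>
    by unfold_locales auto
  show "\<exists>A B. solves_all_cross_distances n q d \<Phi> \<epsilon> \<delta> A B \<and> sketch_size_at_most n d \<Phi> A
     (2000000 * (real n / \<epsilon>\<^sup>2 * (log 2 (real n) * logf (1 / \<epsilon>) + log 2 (real d * real \<Phi>) * logf (real q / \<delta>))
       + (real d ^ 3 + (real d)\<^sup>2 * log 2 (real q / \<delta>) + real d * log 2 (real \<Phi>))))"
    by (rule ex_small_protocol)
qed simp

end
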